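(* Consider the two-user Gaussian multiple-access wiretap channel with degraded message sets and no feedback described in the context, with power constraints $P_1,P_2>0$ and noise variances $\sigma_1^2,\sigma_2^2>0$. Its secrecy capacity region $\mathcal{C}_{s,gmac-dms}$ satisfies $\mathcal{C}_{s,gmac-dms}\subseteq\mathcal{C}^{out}_{s,gmac-dms}$, where \[ \mathcal{C}^{out}_{s,gmac-dms}=\bigcup_{-1\le\rho\le1}\Big\{(R_1\ge0,R_2\ge0):\ R_2\le\tfrac12\log\Big(1+\tfrac{(1-\rho^2)P_2}{\sigma_1^2}\Big), \] \[ R_1+R_2\le\tfrac12\log\Big(1+\tfrac{P_1+P_2+2\sqrt{P_1P_2}\rho}{\sigma_1^2}\Big)-\tfrac12\log\Big(1+\tfrac{P_1+P_2+2\sqrt{P_1P_2}\rho}{\sigma_1^2+\sigma_2^2}\Big)\Big\}. \]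
   Context: All logarithms are base 2. Channel (GMAC-WT-DMS without feedback): for $i=1,\dots,N$, $Y_i=X_{1,i}+X_{2,i}+\eta_{1,i}$ and $Z_i=Y_i+\eta_{2,i}$, where $\eta_{1,i}\sim\mathcal N(0,\sigma_1^2)$, $\eta_{2,i}\sim\mathcal N(0,\sigma_2^2)$ are i.i.d. over $i$, mutually independent, and independent of the messages. Messages $W_1,W_2$ are independent, $W_j$ uniform on $\{1,\dots,|\mathcal W_j|\}$. $X_{1,i}$ is a (possibly stochastic) function of $W_1$ only; $X_{2,i}$ is a (possibly stochastic) function of $(W_1,W_2)$ only. Power constraints: $\frac1N\sum_{i=1}^N E[X_{j,i}^2]\le P_j$. The receiver outputs $(\hat W_1,\hat W_2)=\psi(Y^N)$; $P_e$ is the average probability that $\psi(Y^N)\neq(W_1,W_2)$. Equivocation $\Delta=\frac1N H(W_1,W_2\mid Z^N)$. A pair $(R_1,R_2)$ is achievable with perfect weak secrecy if for every $\epsilon>0$ and all sufficiently large $N$ there exist encoders and a decoder with $\frac{\log|\mathcal W_j|}{N}=R_j$ ($j=1,2$), $\Delta\ge R_1+R_2-\epsilon$ and $P_e\le\epsilon$. $\mathcal{C}_{s,gmac-dms}$ is the set of all such pairs. *)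

theory Defs
  imports "HOL-Probability.Probability"
begin

text \<open>Two-user Gaussian MAC wiretap channel with degraded message sets (no feedback).
  Block length N, message set sizes M1, M2 (messages uniform on {1..M}),
  noise variances s1 = sigma_1^2, s2 = sigma_2^2.
  Stochastic encoders are realised as deterministic measurable functions of the
  message(s) and a private random seed uniform on [0,1] (independent for the two
  encoders); X_{1,i} = f1 w1 u1 i and X_{2,i} = f2 w1 w2 u2 i.\<close>

definition seed_space :: "real measure" where
  "seed_space = uniform_measure lborel {0..1}"

definition noise_space :: "nat \<Rightarrow> real \<Rightarrow> (nat \<Rightarrow> real) measure" where
  "noise_space N s = PiM {..<N} (\<lambda>_. density lborel (normal_density 0 (sqrt s)))"

definition exp_space :: "nat \<Rightarrow> nat \<Rightarrow> nat \<Rightarrow> real \<Rightarrow> real \<Rightarrow>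
    (nat \<times> nat \<times> real \<times> real \<times> (nat \<Rightarrow> real) \<times> (nat \<Rightarrow> real)) measure" where
  "exp_space N M1 M2 s1 s2 =
     uniform_count_measure {1..M1} \<Otimes>\<^sub>M uniform_count_measure {1..M2} \<Otimes>\<^sub>M
     seed_space \<Otimes>\<^sub>M seed_space \<Otimes>\<^sub>M noise_space N s1 \<Otimes>\<^sub>M noise_space N s2"

definition msgs :: "nat \<times> nat \<times> real \<times> real \<times> (nat \<Rightarrow> real) \<times> (nat \<Rightarrow> real) \<Rightarrow> nat \<times> nat" where
  "msgs \<omega> = (case \<omega> of (w1, w2, u1, u2, n1, n2) \<Rightarrow> (w1, w2))"

definition chan_X1 :: "(nat \<Rightarrow> real \<Rightarrow> nat \<Rightarrow> real) \<Rightarrow>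
    nat \<times> nat \<times> real \<times> real \<times> (nat \<Rightarrow> real) \<times> (nat \<Rightarrow> real) \<Rightarrow> nat \<Rightarrow> real" where
  "chan_X1 f1 \<omega> = (case \<omega> of (w1, w2, u1, u2, n1, n2) \<Rightarrow> f1 w1 u1)"

definition chan_X2 :: "(nat \<Rightarrow> nat \<Rightarrow> real \<Rightarrow> nat \<Rightarrow> real) \<Rightarrow>
    nat \<times> nat \<times> real \<times> real \<times> (nat \<Rightarrow> real) \<times> (nat \<Rightarrow> real) \<Rightarrow> nat \<Rightarrow> real" where
  "chan_X2 f2 \<omega> = (case \<omega> of (w1, w2, u1, u2, n1, n2) \<Rightarrow> f2 w1 w2 u2)"

definition chan_Y :: "nat \<Rightarrow> (nat \<Rightarrow> real \<Rightarrow> nat \<Rightarrow> real) \<Rightarrow> (nat \<Rightarrow> nat \<Rightarrow> real \<Rightarrow> nat \<Rightarrow> real) \<Rightarrow>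
    nat \<times> nat \<times> real \<times> real \<times> (nat \<Rightarrow> real) \<times> (nat \<Rightarrow> real) \<Rightarrow> nat \<Rightarrow> real" where
  "chan_Y N f1 f2 \<omega> = (case \<omega> of (w1, w2, u1, u2, n1, n2) \<Rightarrow>
     (\<lambda>i\<in>{..<N}. f1 w1 u1 i + f2 w1 w2 u2 i + n1 i))"

definition chan_Z :: "nat \<Rightarrow> (nat \<Rightarrow> real \<Rightarrow> nat \<Rightarrow> real) \<Rightarrow> (nat \<Rightarrow> nat \<Rightarrow> real \<Rightarrow> nat \<Rightarrow> real) \<Rightarrow>
    nat \<times> nat \<times> real \<times> real \<times> (nat \<Rightarrow> real) \<times> (nat \<Rightarrow> real) \<Rightarrow> nat \<Rightarrow> real" where
  "chan_Z N f1 f2 \<omega> = (case \<omega> of (w1, w2, u1, u2, n1, n2) \<Rightarrow>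
     (\<lambda>i\<in>{..<N}. f1 w1 u1 i + f2 w1 w2 u2 i + n1 i + n2 i))"

definition valid_code :: "nat \<Rightarrow> nat \<Rightarrow> nat \<Rightarrow> real \<Rightarrow> real \<Rightarrow> real \<Rightarrow> real \<Rightarrow>
    (nat \<Rightarrow> real \<Rightarrow> nat \<Rightarrow> real) \<Rightarrow> (nat \<Rightarrow> nat \<Rightarrow> real \<Rightarrow> nat \<Rightarrow> real) \<Rightarrow>
    ((nat \<Rightarrow> real) \<Rightarrow> nat \<times> nat) \<Rightarrow> bool" where
  "valid_code N M1 M2 P1 P2 s1 s2 f1 f2 \<psi> \<longleftrightarrow>
     1 \<le> M1 \<and> 1 \<le> M2 \<and>
     (\<forall>w1 i. (\<lambda>u. f1 w1 u i) \<in> borel_measurable borel) \<and>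
     (\<forall>w1 w2 i. (\<lambda>u. f2 w1 w2 u i) \<in> borel_measurable borel) \<and>
     \<psi> \<in> measurable (PiM {..<N} (\<lambda>_. borel)) (count_space UNIV) \<and>
     (\<Sum>i<N. \<integral>\<^sup>+ \<omega>. ennreal ((chan_X1 f1 \<omega> i)\<^sup>2) \<partial>exp_space N M1 M2 s1 s2)
        \<le> ennreal (real N * P1) \<and>
     (\<Sum>i<N. \<integral>\<^sup>+ \<omega>. ennreal ((chan_X2 f2 \<omega> i)\<^sup>2) \<partial>exp_space N M1 M2 s1 s2)
        \<le> ennreal (real N * P2)"

definition err_prob :: "nat \<Rightarrow> nat \<Rightarrow> nat \<Rightarrow> real \<Rightarrow> real \<Rightarrow>
    (nat \<Rightarrow> real \<Rightarrow> nat \<Rightarrow> real) \<Rightarrow> (nat \<Rightarrow> nat \<Rightarrow> real \<Rightarrow> nat \<Rightarrow> real) \<Rightarrow>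
    ((nat \<Rightarrow> real) \<Rightarrow> nat \<times> nat) \<Rightarrow> real" where
  "err_prob N M1 M2 s1 s2 f1 f2 \<psi> =
     measure (exp_space N M1 M2 s1 s2)
       {\<omega> \<in> space (exp_space N M1 M2 s1 s2). \<psi> (chan_Y N f1 f2 \<omega>) \<noteq> msgs \<omega>}"

definition equivocation :: "nat \<Rightarrow> nat \<Rightarrow> nat \<Rightarrow> real \<Rightarrow> real \<Rightarrow>
    (nat \<Rightarrow> real \<Rightarrow> nat \<Rightarrow> real) \<Rightarrow> (nat \<Rightarrow> nat \<Rightarrow> real \<Rightarrow> nat \<Rightarrow> real) \<Rightarrow> real" where
  "equivocation N M1 M2 s1 s2 f1 f2 =
     prob_space.conditional_entropy (exp_space N M1 M2 s1 s2) 2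
       (count_space UNIV) (PiM {..<N} (\<lambda>_. lborel)) msgs (chan_Z N f1 f2) / real N"

definition secrecy_region :: "real \<Rightarrow> real \<Rightarrow> real \<Rightarrow> real \<Rightarrow> (real \<times> real) set" where
  "secrecy_region P1 P2 s1 s2 = {(R1, R2).
     \<forall>\<epsilon>>0. \<exists>N0. \<forall>N\<ge>N0. \<exists>M1 M2 f1 f2 \<psi>.
       valid_code N M1 M2 P1 P2 s1 s2 f1 f2 \<psi> \<and>
       log 2 (real M1) / real N = R1 \<and> log 2 (real M2) / real N = R2 \<and>
       equivocation N M1 M2 s1 s2 f1 f2 \<ge> R1 + R2 - \<epsilon> \<and>
       err_prob N M1 M2 s1 s2 f1 f2 \<psi> \<le> \<epsilon>}"

definition outer_region :: "real \<Rightarrow> real \<Rightarrow> real \<Rightarrow> real \<Rightarrow> (real \<times> real) set" where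
  "outer_region P1 P2 s1 s2 = (\<Union>\<rho>\<in>{-1..1}. {(R1, R2). R1 \<ge> 0 \<and> R2 \<ge> 0 \<and>
     R2 \<le> 1/2 * log 2 (1 + (1 - \<rho>\<^sup>2) * P2 / s1) \<and>
     R1 + R2 \<le> 1/2 * log 2 (1 + (P1 + P2 + 2 * sqrt (P1 * P2) * \<rho>) / s1)
               - 1/2 * log 2 (1 + (P1 + P2 + 2 * sqrt (P1 * P2) * \<rho>) / (s1 + s2))})"

end

theory Submission
  imports Defs
begin

text \<open>
  Both rate bounds are instances of \<open>E (ln T) \<le> 0\<close> for a positive \<open>T\<close> with \<open>E T \<le> 1\<close>; Fano's
  inequality is absorbed by a test distribution \<open>\<kappa>\<close> which gives mass at least \<open>1/2\<close> to the
  decoder output and spreads \<open>1/2\<close> uniformly over the messages.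

  Sum rate: \<open>T = \<kappa>(W|Y) r(Y|Z) p(Z) p(Z|X) / (p(W,Z) p(Y|X) p(Z|Y))\<close> with \<open>r\<close> the Gaussian
  centred at the linear MMSE estimate \<open>a Z\<close> of \<open>Y\<close>. This bounds \<open>H(W|Z)\<close> by
  \<open>N/2 ln ((Q + s1) (s1 + s2) / (s1 (Q + s1 + s2)))\<close> plus a Fano term, where \<open>Q = P1 + P2 + 2c\<close>
  and \<open>c\<close> is the average of \<open>E (X1 X2)\<close>.

  Rate of user 2: \<open>T = M2 \<kappa>(W2|Y) r(Y|X1) / p(Y|X)\<close> with \<open>r\<close> the Gaussian centred at
  \<open>(1 + c/P1) X1\<close>. Here \<open>E T \<le> 1\<close> because \<open>W2\<close> is independent of \<open>X1\<close>, and the residual power of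
  \<open>X2 - (c/P1) X1\<close> is at most \<open>P2 - c^2/P1\<close>, which is \<open>(1 - \<rho>^2) P2\<close> for \<open>\<rho> = c / sqrt (P1 P2)\<close>.

  The correlation \<open>\<rho>\<close> depends on the code; compactness of \<open>[-1, 1]\<close> yields one that works in the limit.
\<close>

section \<open>Gaussian product densities\<close>

text \<open>Density at \<open>y\<close> of the \<open>N\<close>-dimensional Gaussian with mean
  vector \<open>x\<close> and covariance \<open>s\<close> times the identity. The parameter
  \<open>s\<close> is a variance, while \<open>normal_density\<close> expects a standard
  deviation.\<close>

definition gauss :: "nat \<Rightarrow> real \<Rightarrow> (nat \<Rightarrow> real) \<Rightarrow> (nat \<Rightarrow> real) \<Rightarrow> real" where
  "gauss N s x y = (\<Prod>i<N. normal_density (x i) (sqrt s) (y i))"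

abbreviation Leb :: "nat \<Rightarrow> (nat \<Rightarrow> real) measure" where
  "Leb N \<equiv> PiM {..<N} (\<lambda>_. lborel)"

interpretation lborel_PiM: product_sigma_finite "\<lambda>_::nat. lborel :: real measure"
  by standard

lemma sigma_finite_Leb: "sigma_finite_measure (Leb N)"
  by (intro lborel_PiM.sigma_finite) simp

lemma measurable_normal_density [measurable (raw)]:
  assumes [measurable]: "f \<in> borel_measurable M" "g \<in> borel_measurable M"
  shows "(\<lambda>\<omega>. normal_density (f \<omega>) \<sigma> (g \<omega>)) \<in> borel_measurable M"
  unfolding normal_density_def by measurable

lemma measurable_gauss [measurable (raw)]:
  assumes "\<And>i. i < N \<Longrightarrow> (\<lambda>\<omega>. f \<omega> i) \<in> borel_measurable M"
    and "\<And>i. i < N \<Longrightarrow> (\<lambda>\<omega>. g \<omega> i) \<in> borel_measurable M"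
  shows "(\<lambda>\<omega>. gauss N s (f \<omega>) (g \<omega>)) \<in> borel_measurable M"
  unfolding gauss_def normal_density_def using assms by measurable

lemma gauss_pos: "s > 0 \<Longrightarrow> gauss N s x y > 0"
  unfolding gauss_def by (intro prod_pos) (auto intro!: normal_density_pos)

lemma gauss_nonneg [simp]: "gauss N s x y \<ge> 0"
  unfolding gauss_def by (intro prod_nonneg) auto

lemma ennreal_gauss: "ennreal (gauss N s x y) = (\<Prod>i<N. ennreal (normal_density (x i) (sqrt s) (y i)))"
  unfolding gauss_def by (intro prod_ennreal[symmetric]) auto

text \<open>The bound is the peak value of the density. It is uniform in the mean, which makes every
  mixture of such densities over the channel inputs finite.\<close>

lemma gauss_le:
  assumes "s > 0"
  shows "gauss N s x y \<le> (1 / sqrt (2 * pi * s)) ^ N"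
proof -
  have "gauss N s x y \<le> (\<Prod>i<N. 1 / sqrt (2 * pi * s))"
    unfolding gauss_def normal_density_def using assms
    by (intro prod_mono) (auto intro!: divide_right_mono simp: divide_nonneg_pos)
  then show ?thesis by simp
qed

text \<open>The logarithm is a constant minus a scaled squared distance, so expected log densities
  are determined by second moments alone.\<close>

lemma ln_gauss:
  assumes "s > 0"
  shows "ln (gauss N s x y) = - (real N / 2) * ln (2 * pi * s) - (\<Sum>i<N. (y i - x i)\<^sup>2) / (2 * s)"
proof -
  have "ln (gauss N s x y) = (\<Sum>i<N. ln (normal_density (x i) (sqrt s) (y i)))"
    unfolding gauss_def using assms by (intro ln_prod) (auto simp: normal_density_pos less_imp_neq[OF normal_density_pos, symmetric])
  also have "\<dots> = (\<Sum>i<N. - (1/2) * ln (2 * pi * s) - (y i - x i)\<^sup>2 / (2 * s))"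
    using assms unfolding normal_density_def
    by (intro sum.cong) (auto simp: ln_mult ln_div ln_sqrt)
  finally show ?thesis
    by (simp add: sum_subtractf sum_divide_distrib sum_distrib_left)
qed

lemma nn_integral_gauss:
  assumes "s > 0"
  shows "(\<integral>\<^sup>+ y. gauss N s x y \<partial>Leb N) = 1"
proof -
  have 1: "(\<integral>\<^sup>+ y. ennreal (normal_density m (sqrt s) y) \<partial>lborel) = 1" for m
    using assms by (simp add: nn_integral_eq_integral)
  show ?thesis
    unfolding ennreal_gauss
    by (subst lborel_PiM.product_nn_integral_prod[of _ "\<lambda>i y. ennreal (normal_density (x i) (sqrt s) y)"]) (auto simp: 1)
qed

text \<open>Coordinatewise this is a convolution of normal densities: independent noises add their
  variances. It removes \<open>y\<close> and leaves the density of \<open>Z\<close> given the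
  input.\<close>

lemma nn_integral_gauss_conv:
  assumes "s > 0" "t > 0"
  shows "(\<integral>\<^sup>+ y. ennreal (gauss N s x y) * ennreal (gauss N t y z) \<partial>Leb N) = gauss N (s + t) x z"
proof -
  have 1: "(\<integral>\<^sup>+ y. ennreal (normal_density a (sqrt s) y) * ennreal (normal_density y (sqrt t) c) \<partial>lborel)
      = ennreal (normal_density a (sqrt (s + t)) c)" for a c
  proof -
    have shift: "normal_density a (sqrt s) (a + y) = normal_density 0 (sqrt s) y"
        "normal_density (a + y) (sqrt t) c = normal_density 0 (sqrt t) (c - (a + y))" for y
      by (simp_all add: normal_density_def)
    \<comment> \<open>Translating \<open>y\<close> by \<open>a\<close> centres both densities, the
      form treated by \<open>conv_normal_density_zero_mean\<close>.\<close>
    have "(\<integral>\<^sup>+ y. ennreal (normal_density a (sqrt s) y) * ennreal (normal_density y (sqrt t) c) \<partial>lborel)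
      = (\<integral>\<^sup>+ y. ennreal (normal_density 0 (sqrt t) ((c - a) - y) * normal_density 0 (sqrt s) y) \<partial>lborel)"
      by (subst nn_integral_real_affine[where c=1 and t=a])
         (simp_all add: shift ennreal_mult[symmetric] mult.commute diff_diff_eq)
    also have "\<dots> = normal_density 0 (sqrt (s + t)) (c - a)"
      using conv_normal_density_zero_mean[of "sqrt t" "sqrt s"] assms
      by (auto simp: fun_eq_iff add.commute)
    finally show ?thesis by (simp add: normal_density_def)
  qed
  show ?thesis
    unfolding ennreal_gauss prod.distrib[symmetric]
    by (subst lborel_PiM.product_nn_integral_prod[of _ "\<lambda>i y. ennreal (normal_density (x i) (sqrt s) y) * ennreal (normal_density y (sqrt t) (z i))"])
       (auto simp: 1)
qed

text \<open>Passes from the concrete noise space to Lebesgue measure: a fixed vector plus Gaussian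
  noise has the density \<open>gauss\<close> centred at that vector.\<close>

lemma noise_shift:
  assumes [measurable]: "F \<in> borel_measurable (Leb N)" and "s > 0"
  shows "(\<integral>\<^sup>+ n. F (\<lambda>i\<in>{..<N}. x i + n i) \<partial>noise_space N s) = (\<integral>\<^sup>+ y. ennreal (gauss N s x y) * F y \<partial>Leb N)"
proof -
  define G where "G = density lborel (\<lambda>y. ennreal (normal_density 0 (sqrt s) y))"
  interpret G: prob_space G unfolding G_def using assms by (intro prob_space_normal_density) simp
  interpret GP: product_sigma_finite "\<lambda>_::nat. G" by standard
  have [measurable]: "(\<lambda>n. \<lambda>i\<in>{..<N}. x i + n i) \<in> noise_space N s \<rightarrow>\<^sub>M Leb N"
    unfolding noise_space_def by measurable
  have G_shift: "emeasure G {n. m + n \<in> A} = (\<integral>\<^sup>+ y. ennreal (normal_density m (sqrt s) y) * indicator A y \<partial>lborel)"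
    if [measurable]: "A \<in> sets borel" for A m
  proof -
    have "emeasure G {n. m + n \<in> A} = (\<integral>\<^sup>+ y. ennreal (normal_density 0 (sqrt s) y) * indicator A (m + y) \<partial>lborel)"
      unfolding G_def by (subst emeasure_density) (auto intro!: nn_integral_cong simp: indicator_def)
    also have "\<dots> = (\<integral>\<^sup>+ y. ennreal (normal_density m (sqrt s) y) * indicator A y \<partial>lborel)"
      by (subst (2) nn_integral_real_affine[where c=1 and t=m]) (auto simp: normal_density_def)
    finally show ?thesis .
  qed
  \<comment> \<open>Both measures are compared on boxes, which generate the product sigma-algebra
    and on which both sides factor over the coordinates.\<close>
  have "distr (noise_space N s) (Leb N) (\<lambda>n. \<lambda>i\<in>{..<N}. x i + n i) = density (Leb N) (gauss N s x)"
  proof (rule measure_eqI_PiM_finite[of "{..<N}" _ "\<lambda>_. lborel"])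
    fix A assume A: "\<And>i. i \<in> {..<N} \<Longrightarrow> A i \<in> sets (lborel :: real measure)"
    have [measurable]: "Pi\<^sub>E {..<N} A \<in> sets (Leb N)" using A by (intro sets_PiM_I_finite) auto
    have "emeasure (distr (noise_space N s) (Leb N) (\<lambda>n. \<lambda>i\<in>{..<N}. x i + n i)) (Pi\<^sub>E {..<N} A)
        = emeasure (noise_space N s) (Pi\<^sub>E {..<N} (\<lambda>i. {n. x i + n \<in> A i}))"
    proof -
      have "(\<lambda>n. \<lambda>i\<in>{..<N}. x i + n i) -` Pi\<^sub>E {..<N} A \<inter> space (noise_space N s)
          = Pi\<^sub>E {..<N} (\<lambda>i. {n. x i + n \<in> A i})"
        by (rule set_eqI) (simp add: noise_space_def space_PiM PiE_iff)
      moreover have "Pi\<^sub>E {..<N} A \<in> sets (Leb N)" by measurable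
      ultimately show ?thesis by (subst emeasure_distr) simp_all
    qed
    also have "\<dots> = (\<Prod>i<N. emeasure G {n. x i + n \<in> A i})"
      unfolding noise_space_def G_def[symmetric]
    proof (intro GP.emeasure_PiM)
      fix i assume "i \<in> {..<N}"
      then have [measurable]: "A i \<in> sets borel" using A by simp
      have "{n. x i + n \<in> A i} \<in> sets borel" by measurable
      then show "{n. x i + n \<in> A i} \<in> sets G" by (simp add: G_def)
    qed simp
    also have "\<dots> = (\<Prod>i<N. \<integral>\<^sup>+ y. ennreal (normal_density (x i) (sqrt s) y) * indicator (A i) y \<partial>lborel)"
      using A by (intro prod.cong G_shift) auto
    also have "\<dots> = (\<integral>\<^sup>+ y. (\<Prod>i<N. ennreal (normal_density (x i) (sqrt s) (y i)) * indicator (A i) (y i)) \<partial>Leb N)"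
      using A by (subst lborel_PiM.product_nn_integral_prod[of _ "\<lambda>i y. ennreal (normal_density (x i) (sqrt s) y) * indicator (A i) y"]) auto
    also have "\<dots> = (\<integral>\<^sup>+ y. ennreal (gauss N s x y) * indicator (Pi\<^sub>E {..<N} A) y \<partial>Leb N)"
    proof (intro nn_integral_cong)
      fix y assume "y \<in> space (Leb N)"
      then have "(\<Prod>i<N. indicator (A i) (y i)) = (indicator (Pi\<^sub>E {..<N} A) y :: ennreal)"
        by (cases "y \<in> Pi\<^sub>E {..<N} A") (auto simp: PiE_iff space_PiM indicator_eq_0_iff)
      then show "(\<Prod>i<N. ennreal (normal_density (x i) (sqrt s) (y i)) * indicator (A i) (y i)) =
          ennreal (gauss N s x y) * indicator (Pi\<^sub>E {..<N} A) y"
        by (simp add: ennreal_gauss prod.distrib)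
    qed
    also have "\<dots> = emeasure (density (Leb N) (gauss N s x)) (Pi\<^sub>E {..<N} A)"
      by (subst emeasure_density) auto
    finally show "emeasure (distr (noise_space N s) (Leb N) (\<lambda>n. \<lambda>i\<in>{..<N}. x i + n i)) (Pi\<^sub>E {..<N} A) = \<dots>" .
  next
    interpret GN: prob_space "noise_space N s"
      unfolding noise_space_def G_def[symmetric] by (intro prob_space_PiM) unfold_locales
    \<comment> \<open>The constant sequence \<open>space (Leb N)\<close> exhausts the space, and its
      mass is finite because the noise law is a probability measure.\<close>
    show "range (\<lambda>_::nat. space (Leb N)) \<subseteq> prod_algebra {..<N} (\<lambda>_. lborel)"
      by (auto simp: space_PiM intro!: prod_algebraI_finite)
    show "emeasure (distr (noise_space N s) (Leb N) (\<lambda>n. \<lambda>i\<in>{..<N}. x i + n i)) (space (Leb N)) \<noteq> \<infinity>" for i :: nat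
      by (subst emeasure_distr) auto
  qed auto
  then have "(\<integral>\<^sup>+ y. F y \<partial>distr (noise_space N s) (Leb N) (\<lambda>n. \<lambda>i\<in>{..<N}. x i + n i)) = (\<integral>\<^sup>+ y. F y \<partial>density (Leb N) (gauss N s x))"
    by simp
  then show ?thesis
    by (simp add: nn_integral_distr nn_integral_density)
qed

text \<open>Expanding the square around the mean \<open>x i\<close>, the linear term vanishes by
  symmetry and the quadratic term contributes the variance.\<close>

lemma nn_integral_gauss_square:
  assumes "s > 0" "i < N"
  shows "(\<integral>\<^sup>+ y. ennreal (gauss N s x y) * ennreal ((c + d * y i)\<^sup>2) \<partial>Leb N) = ennreal ((c + d * x i)\<^sup>2 + d\<^sup>2 * s)"
proof -
  let ?f = "normal_density (x i) (sqrt s)"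
  have pos: "sqrt s > 0" using assms by simp
  have 1: "(\<integral>\<^sup>+ y. ennreal (normal_density m (sqrt s) y) \<partial>lborel) = 1" for m
    using assms by (simp add: nn_integral_eq_integral)
  \<comment> \<open>Moments of order 0, 1 and 2; the exponents are spelled as \<open>2 * k\<close>
    or \<open>2 * k + 1\<close> to match the rules for even and odd moments.\<close>
  have "has_bochner_integral lborel (\<lambda>y. (c + d * x i)\<^sup>2 * (?f y * (y - x i) ^ (2 * 0))
      + 2 * (c + d * x i) * d * (?f y * (y - x i) ^ (2 * 0 + 1)) + d\<^sup>2 * (?f y * (y - x i) ^ (2 * 1)))
      ((c + d * x i)\<^sup>2 * (fact (2 * 0) / ((2 / (sqrt s)\<^sup>2) ^ 0 * fact 0)) + 2 * (c + d * x i) * d * 0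
       + d\<^sup>2 * (fact (2 * 1) / ((2 / (sqrt s)\<^sup>2) ^ 1 * fact 1)))"
    by (intro has_bochner_integral_add has_bochner_integral_mult_right
        normal_moment_even normal_moment_odd pos)
  also have "(\<lambda>y. (c + d * x i)\<^sup>2 * (?f y * (y - x i) ^ (2 * 0))
      + 2 * (c + d * x i) * d * (?f y * (y - x i) ^ (2 * 0 + 1)) + d\<^sup>2 * (?f y * (y - x i) ^ (2 * 1)))
      = (\<lambda>y. ?f y * (c + d * y)\<^sup>2)"
    by (auto simp: fun_eq_iff power2_eq_square algebra_simps)
  finally have hb: "has_bochner_integral lborel (\<lambda>y. ?f y * (c + d * y)\<^sup>2) ((c + d * x i)\<^sup>2 + d\<^sup>2 * s)"
    using assms by simp
  have 2: "(\<integral>\<^sup>+ y. ennreal (?f y) * ennreal ((c + d * y)\<^sup>2) \<partial>lborel) = ennreal ((c + d * x i)\<^sup>2 + d\<^sup>2 * s)"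
    using hb nn_integral_eq_integral[of lborel "\<lambda>y. ?f y * (c + d * y)\<^sup>2"]
    by (simp add: ennreal_mult[symmetric] has_bochner_integral_iff)
  \<comment> \<open>The square is written as a product with factor 1 at every coordinate other than
    \<open>i\<close>, so that the integral factors.\<close>
  let ?g = "\<lambda>j y. ennreal (normal_density (x j) (sqrt s) y) * (if j = i then ennreal ((c + d * y)\<^sup>2) else 1)"
  have "(\<integral>\<^sup>+ y. ennreal (gauss N s x y) * ennreal ((c + d * y i)\<^sup>2) \<partial>Leb N) = (\<integral>\<^sup>+ y. (\<Prod>j<N. ?g j (y j)) \<partial>Leb N)"
    using assms by (intro nn_integral_cong) (simp add: ennreal_gauss prod.distrib prod.delta)
  also have "\<dots> = (\<Prod>j<N. \<integral>\<^sup>+ y. ?g j y \<partial>lborel)"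
    by (intro lborel_PiM.product_nn_integral_prod) auto
  also have "\<dots> = (\<Prod>j<N. if j = i then ennreal ((c + d * x i)\<^sup>2 + d\<^sup>2 * s) else 1)"
    by (intro prod.cong) (auto simp: 1 2)
  also have "\<dots> = ennreal ((c + d * x i)\<^sup>2 + d\<^sup>2 * s)"
    using assms by (simp add: prod.delta)
  finally show ?thesis .
qed

text \<open>From \<open>ln t \<le> t - 1\<close> the expectation is at most \<open>E T - 1\<close>.
  Positivity is asked for only almost everywhere because the density \<open>pWZ\<close>, a
  denominator of the test ratio used later, is known to be positive only almost surely.\<close>

lemma (in prob_space) gibbs:
  fixes T :: "'a \<Rightarrow> real"
  assumes [measurable]: "T \<in> borel_measurable M"
    and pos: "AE \<omega> in M. T \<omega> > 0" and le: "(\<integral>\<^sup>+ \<omega>. ennreal (T \<omega>) \<partial>M) \<le> 1"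
    and int: "integrable M (\<lambda>\<omega>. ln (T \<omega>))"
  shows "expectation (\<lambda>\<omega>. ln (T \<omega>)) \<le> 0"
proof -
  have nn: "AE \<omega> in M. 0 \<le> T \<omega>" using pos by auto
  have iT: "integrable M T"
    using le nn by (intro integrableI_nonneg) (auto simp: order_le_less_trans)
  have "expectation (\<lambda>\<omega>. ln (T \<omega>)) \<le> expectation (\<lambda>\<omega>. T \<omega> - 1)"
    using pos iT int by (intro integral_mono_AE) (auto intro: ln_le_minus_one)
  also have "\<dots> = expectation T - 1" using iT by (simp add: prob_space)
  also have "expectation T \<le> 1"
    using le nn_integral_eq_integral[OF iT nn] integral_nonneg_AE[OF nn] by simp
  finally show ?thesis by simp
qed

section \<open>The degraded Gaussian channel\<close>

text \<open>\<open>B\<close> is the space of all channel inputs (messages and seeds) and \<open>b\<close> the random input.\<close>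

locale gaussian_wiretap = prob_space M + B: prob_space B
  for M :: "'a measure" and B :: "'b measure" +
  fixes N :: nat and s1 s2 :: real and X :: "'b \<Rightarrow> nat \<Rightarrow> real"
    and W :: "'b \<Rightarrow> 'w::countable" and A :: "'w set"
    and b :: "'a \<Rightarrow> 'b" and Y Z :: "'a \<Rightarrow> nat \<Rightarrow> real"
  assumes s1_pos: "s1 > 0" and s2_pos: "s2 > 0"
    and X_meas: "\<And>i. i < N \<Longrightarrow> (\<lambda>\<beta>. X \<beta> i) \<in> borel_measurable B"
    and W_meas [measurable]: "W \<in> B \<rightarrow>\<^sub>M count_space UNIV"
    and fin_A: "finite A" and W_A: "\<And>\<beta>. \<beta> \<in> space B \<Longrightarrow> W \<beta> \<in> A"
    and joint: "distributed M (B \<Otimes>\<^sub>M Leb N \<Otimes>\<^sub>M Leb N) (\<lambda>\<omega>. (b \<omega>, Y \<omega>, Z \<omega>))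
      (\<lambda>(\<beta>, y, z). ennreal (gauss N s1 (X \<beta>) y) * ennreal (gauss N s2 y z))"
begin

text \<open>Lebesgue density of \<open>Z\<close>: the density of the output given the input,
  averaged over the inputs. The average is finite, so \<open>enn2real\<close> loses nothing.\<close>

definition pZ :: "(nat \<Rightarrow> real) \<Rightarrow> real" where
  "pZ z = enn2real (\<integral>\<^sup>+ \<beta>. ennreal (gauss N (s1 + s2) (X \<beta>) z) \<partial>B)"

text \<open>Joint density of message and \<open>Z\<close> with respect to counting measure times
  Lebesgue measure; the quotient by \<open>pZ\<close> is the posterior of the message.\<close>

definition pWZ :: "'w \<Rightarrow> (nat \<Rightarrow> real) \<Rightarrow> real" where
  "pWZ w z = enn2real (\<integral>\<^sup>+ \<beta>. ennreal (gauss N (s1 + s2) (X \<beta>) z) * indicator {w} (W \<beta>) \<partial>B)"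

sublocale L: sigma_finite_measure "Leb N" by (rule sigma_finite_Leb)
sublocale LL: pair_sigma_finite "Leb N" "Leb N" ..
sublocale BL: pair_sigma_finite B "Leb N" ..

section \<open>Expectations over the experiment as iterated integrals\<close>

lemma bYZ_meas [measurable]:
  "b \<in> M \<rightarrow>\<^sub>M B" "Y \<in> M \<rightarrow>\<^sub>M Leb N" "Z \<in> M \<rightarrow>\<^sub>M Leb N"
proof -
  have "(\<lambda>\<omega>. (b \<omega>, Y \<omega>, Z \<omega>)) \<in> M \<rightarrow>\<^sub>M B \<Otimes>\<^sub>M Leb N \<Otimes>\<^sub>M Leb N"
    using joint by (rule distributed_measurable)
  from measurable_compose[OF this measurable_fst]
    measurable_compose[OF measurable_compose[OF this measurable_snd] measurable_fst]
    measurable_compose[OF measurable_compose[OF this measurable_snd] measurable_snd]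
  show "b \<in> M \<rightarrow>\<^sub>M B" "Y \<in> M \<rightarrow>\<^sub>M Leb N" "Z \<in> M \<rightarrow>\<^sub>M Leb N" by simp_all
qed

lemma Leb_coord [measurable (raw)]: "i < N \<Longrightarrow> f \<in> M' \<rightarrow>\<^sub>M Leb N \<Longrightarrow> (\<lambda>\<omega>. f \<omega> i) \<in> borel_measurable M'"
  using measurable_compose[OF _ measurable_component_singleton[of i "{..<N}" "\<lambda>_. lborel"]] by simp

lemma X_meas' [measurable (raw)]: "i < N \<Longrightarrow> f \<in> M' \<rightarrow>\<^sub>M B \<Longrightarrow> (\<lambda>\<omega>. X (f \<omega>) i) \<in> borel_measurable M'"
  using measurable_compose[OF _ X_meas[of i]] by simp

text \<open>Starting point of every later computation of \<open>E T\<close> and of second moments: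
  the channel density appears explicitly and can be cancelled or integrated out.\<close>

lemma nn_joint:
  assumes [measurable]: "case_prod (\<lambda>\<beta>. case_prod (F \<beta>)) \<in> borel_measurable (B \<Otimes>\<^sub>M Leb N \<Otimes>\<^sub>M Leb N)"
  shows "(\<integral>\<^sup>+ \<omega>. F (b \<omega>) (Y \<omega>) (Z \<omega>) \<partial>M) =
    (\<integral>\<^sup>+ \<beta>. \<integral>\<^sup>+ y. \<integral>\<^sup>+ z. ennreal (gauss N s1 (X \<beta>) y) * ennreal (gauss N s2 y z) * F \<beta> y z \<partial>Leb N \<partial>Leb N \<partial>B)"
proof -
  have "(\<integral>\<^sup>+ \<omega>. F (b \<omega>) (Y \<omega>) (Z \<omega>) \<partial>M) = (\<integral>\<^sup>+ p. (case p of (\<beta>, y, z) \<Rightarrow> ennreal (gauss N s1 (X \<beta>) y) * ennreal (gauss N s2 y z))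
     * (case p of (\<beta>, y, z) \<Rightarrow> F \<beta> y z) \<partial>(B \<Otimes>\<^sub>M Leb N \<Otimes>\<^sub>M Leb N))"
    by (subst distributed_nn_integral[OF joint]) simp_all
  also have "\<dots> = (\<integral>\<^sup>+ \<beta>. \<integral>\<^sup>+ p. (case p of (y, z) \<Rightarrow> ennreal (gauss N s1 (X \<beta>) y) * ennreal (gauss N s2 y z))
     * (case p of (y, z) \<Rightarrow> F \<beta> y z) \<partial>(Leb N \<Otimes>\<^sub>M Leb N) \<partial>B)"
    by (subst LL.P.nn_integral_fst[symmetric]) simp_all
  also have "\<dots> = (\<integral>\<^sup>+ \<beta>. \<integral>\<^sup>+ y. \<integral>\<^sup>+ z. ennreal (gauss N s1 (X \<beta>) y) * ennreal (gauss N s2 y z) * F \<beta> y z \<partial>Leb N \<partial>Leb N \<partial>B)"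
    by (intro nn_integral_cong, subst L.nn_integral_fst[symmetric]) simp_all
  finally show ?thesis .
qed

text \<open>Tonelli, applied repeatedly, makes the input the innermost variable: for fixed outputs
  the average over the inputs can be taken first.\<close>

lemma swap3:
  assumes [measurable]: "case_prod (\<lambda>\<beta>. case_prod (F \<beta>)) \<in> borel_measurable (B \<Otimes>\<^sub>M Leb N \<Otimes>\<^sub>M Leb N)"
  shows "(\<integral>\<^sup>+ \<beta>. \<integral>\<^sup>+ y. \<integral>\<^sup>+ z. F \<beta> y z \<partial>Leb N \<partial>Leb N \<partial>B) = (\<integral>\<^sup>+ z. \<integral>\<^sup>+ y. \<integral>\<^sup>+ \<beta>. F \<beta> y z \<partial>B \<partial>Leb N \<partial>Leb N)"
proof -
  define G where "G = (\<lambda>(\<beta>, y, z). F \<beta> y z)"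
  have [measurable]: "G \<in> borel_measurable (B \<Otimes>\<^sub>M Leb N \<Otimes>\<^sub>M Leb N)"
    unfolding G_def by measurable
  have F: "F = (\<lambda>\<beta> y z. G (\<beta>, y, z))" by (simp add: G_def)
  have "(\<integral>\<^sup>+ \<beta>. \<integral>\<^sup>+ y. \<integral>\<^sup>+ z. F \<beta> y z \<partial>Leb N \<partial>Leb N \<partial>B) = (\<integral>\<^sup>+ \<beta>. \<integral>\<^sup>+ z. \<integral>\<^sup>+ y. F \<beta> y z \<partial>Leb N \<partial>Leb N \<partial>B)"
    unfolding F by (intro nn_integral_cong LL.Fubini') measurable
  also have "\<dots> = (\<integral>\<^sup>+ z. \<integral>\<^sup>+ \<beta>. \<integral>\<^sup>+ y. F \<beta> y z \<partial>Leb N \<partial>B \<partial>Leb N)"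
    unfolding F by (intro BL.Fubini'[symmetric]) measurable
  also have "\<dots> = (\<integral>\<^sup>+ z. \<integral>\<^sup>+ y. \<integral>\<^sup>+ \<beta>. F \<beta> y z \<partial>B \<partial>Leb N \<partial>Leb N)"
    unfolding F by (intro nn_integral_cong BL.Fubini'[symmetric]) measurable
  finally show ?thesis .
qed

text \<open>The test function ignores \<open>y\<close>, so \<open>y\<close> integrates out and the
  two noise stages merge into one of variance \<open>s1 + s2\<close>.\<close>

lemma nn_WZ:
  assumes [measurable]: "case_prod F \<in> borel_measurable (count_space UNIV \<Otimes>\<^sub>M Leb N)"
  shows "(\<integral>\<^sup>+ \<omega>. F (W (b \<omega>)) (Z \<omega>) \<partial>M) = (\<integral>\<^sup>+ z. \<integral>\<^sup>+ \<beta>. ennreal (gauss N (s1 + s2) (X \<beta>) z) * F (W \<beta>) z \<partial>B \<partial>Leb N)"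
proof -
  have "(\<integral>\<^sup>+ \<omega>. F (W (b \<omega>)) (Z \<omega>) \<partial>M) =
    (\<integral>\<^sup>+ \<beta>. \<integral>\<^sup>+ y. \<integral>\<^sup>+ z. ennreal (gauss N s1 (X \<beta>) y) * ennreal (gauss N s2 y z) * F (W \<beta>) z \<partial>Leb N \<partial>Leb N \<partial>B)"
    by (rule nn_joint) simp
  also have "\<dots> = (\<integral>\<^sup>+ \<beta>. \<integral>\<^sup>+ z. \<integral>\<^sup>+ y. ennreal (gauss N s1 (X \<beta>) y) * ennreal (gauss N s2 y z) * F (W \<beta>) z \<partial>Leb N \<partial>Leb N \<partial>B)"
    by (intro nn_integral_cong LL.Fubini') simp
  also have "\<dots> = (\<integral>\<^sup>+ \<beta>. \<integral>\<^sup>+ z. ennreal (gauss N (s1 + s2) (X \<beta>) z) * F (W \<beta>) z \<partial>Leb N \<partial>B)"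
    by (intro nn_integral_cong) (simp add: nn_integral_multc nn_integral_gauss_conv s1_pos s2_pos)
  also have "\<dots> = (\<integral>\<^sup>+ z. \<integral>\<^sup>+ \<beta>. ennreal (gauss N (s1 + s2) (X \<beta>) z) * F (W \<beta>) z \<partial>B \<partial>Leb N)"
    by (intro BL.Fubini'[symmetric]) simp
  finally show ?thesis .
qed

section \<open>The law of message and eavesdropper output, and the conditional entropy\<close>

lemma nn_pWZ_pZ_finite:
  "(\<integral>\<^sup>+ \<beta>. ennreal (gauss N (s1 + s2) (X \<beta>) z) \<partial>B) < \<infinity>"
  "(\<integral>\<^sup>+ \<beta>. ennreal (gauss N (s1 + s2) (X \<beta>) z) * indicator {w} (W \<beta>) \<partial>B) < \<infinity>"
proof -
  have *: "(\<integral>\<^sup>+ \<beta>. ennreal (gauss N (s1 + s2) (X \<beta>) z) \<partial>B) \<le> (\<integral>\<^sup>+ \<beta>. ennreal ((1 / sqrt (2 * pi * (s1 + s2))) ^ N) \<partial>B)"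
    using s1_pos s2_pos by (intro nn_integral_mono ennreal_leI gauss_le) auto
  then show 1: "(\<integral>\<^sup>+ \<beta>. ennreal (gauss N (s1 + s2) (X \<beta>) z) \<partial>B) < \<infinity>"
    by (rule order_le_less_trans) (simp add: B.emeasure_space_1)
  have "(\<integral>\<^sup>+ \<beta>. ennreal (gauss N (s1 + s2) (X \<beta>) z) * indicator {w} (W \<beta>) \<partial>B) \<le> (\<integral>\<^sup>+ \<beta>. ennreal (gauss N (s1 + s2) (X \<beta>) z) \<partial>B)"
    by (intro nn_integral_mono) (auto simp: indicator_def)
  then show "(\<integral>\<^sup>+ \<beta>. ennreal (gauss N (s1 + s2) (X \<beta>) z) * indicator {w} (W \<beta>) \<partial>B) < \<infinity>"
    using 1 by (rule order_le_less_trans)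
qed

lemma ennreal_pZ: "ennreal (pZ z) = (\<integral>\<^sup>+ \<beta>. ennreal (gauss N (s1 + s2) (X \<beta>) z) \<partial>B)"
  and ennreal_pWZ: "ennreal (pWZ w z) = (\<integral>\<^sup>+ \<beta>. ennreal (gauss N (s1 + s2) (X \<beta>) z) * indicator {w} (W \<beta>) \<partial>B)"
  unfolding pZ_def pWZ_def using nn_pWZ_pZ_finite by simp_all

lemma pZ_nonneg [simp]: "0 \<le> pZ z" and pWZ_nonneg [simp]: "0 \<le> pWZ w z"
  by (simp_all add: pZ_def pWZ_def)

text \<open>A strictly positive function cannot have average 0 over a probability space. The
  conclusion holds at every point.\<close>

lemma pZ_pos: "0 < pZ z"
proof (rule ccontr)
  assume "\<not> 0 < pZ z"
  then have "pZ z = 0" using pZ_nonneg[of z] by linarith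
  then have "(\<integral>\<^sup>+ \<beta>. ennreal (gauss N (s1 + s2) (X \<beta>) z) \<partial>B) = 0" using ennreal_pZ[of z] by simp
  then have "AE \<beta> in B. ennreal (gauss N (s1 + s2) (X \<beta>) z) = 0"
    by (subst (asm) nn_integral_0_iff_AE) auto
  moreover have "ennreal (gauss N (s1 + s2) (X \<beta>) z) \<noteq> 0" for \<beta>
    using gauss_pos[of "s1 + s2" N "X \<beta>" z] s1_pos s2_pos by (simp add: not_le)
  ultimately have "AE \<beta> in B. False" by simp
  then show False using B.AE_False by simp
qed

lemma pZ_meas [measurable]: "pZ \<in> borel_measurable (Leb N)"
  unfolding pZ_def by measurable

lemma pWZ_meas [measurable]: "(\<lambda>(w, z). pWZ w z) \<in> borel_measurable (count_space UNIV \<Otimes>\<^sub>M Leb N)"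
  unfolding pWZ_def by measurable

lemma distributed_Z: "distributed M (Leb N) Z (\<lambda>z. ennreal (pZ z))"
  unfolding distributed_def
proof (intro conjI)
  show "distr M (Leb N) Z = density (Leb N) (\<lambda>z. ennreal (pZ z))"
  proof (rule measure_eqI)
    fix S assume "S \<in> sets (distr M (Leb N) Z)"
    then have [measurable]: "S \<in> sets (Leb N)" by simp
    have "emeasure (distr M (Leb N) Z) S = (\<integral>\<^sup>+ \<omega>. indicator S (Z \<omega>) \<partial>M)"
      using nn_integral_distr[of Z M "Leb N" "indicator S"] by simp
    also have "\<dots> = (\<integral>\<^sup>+ z. \<integral>\<^sup>+ \<beta>. ennreal (gauss N (s1 + s2) (X \<beta>) z) * indicator S z \<partial>B \<partial>Leb N)"
      by (rule nn_WZ[of "\<lambda>w z. indicator S z"]) simp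
    also have "\<dots> = emeasure (density (Leb N) (\<lambda>z. ennreal (pZ z))) S"
      by (simp add: emeasure_density nn_integral_multc ennreal_pZ)
    finally show "emeasure (distr M (Leb N) Z) S = \<dots>" .
  qed simp
qed simp_all

lemma distributed_WZ: "distributed M (count_space UNIV \<Otimes>\<^sub>M Leb N) (\<lambda>\<omega>. (W (b \<omega>), Z \<omega>))
    (\<lambda>p. ennreal (pWZ (fst p) (snd p)))"
  unfolding distributed_def
proof (intro conjI)
  interpret C: sigma_finite_measure "count_space (UNIV :: 'w set)"
    by (rule sigma_finite_measure_count_space)
  interpret CL: pair_sigma_finite "count_space (UNIV :: 'w set)" "Leb N" ..
  interpret CB: pair_sigma_finite "count_space (UNIV :: 'w set)" B ..
  show "distr M (count_space UNIV \<Otimes>\<^sub>M Leb N) (\<lambda>\<omega>. (W (b \<omega>), Z \<omega>)) =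
      density (count_space UNIV \<Otimes>\<^sub>M Leb N) (\<lambda>p. ennreal (pWZ (fst p) (snd p)))" (is "?D = ?E")
  proof (rule measure_eqI)
    fix S assume "S \<in> sets ?D"
    then have [measurable]: "S \<in> sets (count_space UNIV \<Otimes>\<^sub>M Leb N)" by simp
    have "emeasure ?D S = (\<integral>\<^sup>+ \<omega>. indicator S (W (b \<omega>), Z \<omega>) \<partial>M)"
      using nn_integral_distr[of "\<lambda>\<omega>. (W (b \<omega>), Z \<omega>)" M "count_space UNIV \<Otimes>\<^sub>M Leb N" "indicator S"] by simp
    also have "\<dots> = (\<integral>\<^sup>+ z. \<integral>\<^sup>+ \<beta>. ennreal (gauss N (s1 + s2) (X \<beta>) z) * indicator S (W \<beta>, z) \<partial>B \<partial>Leb N)"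
      by (rule nn_WZ) simp
    \<comment> \<open>The value at \<open>W \<beta>\<close> is rewritten as a sum over all messages,
      so that this sum can be exchanged with the average over the inputs.\<close>
    also have "\<dots> = (\<integral>\<^sup>+ z. \<integral>\<^sup>+ \<beta>. \<integral>\<^sup>+ w. (ennreal (gauss N (s1 + s2) (X \<beta>) z) * indicator S (w, z)) * indicator {W \<beta>} w
        \<partial>count_space UNIV \<partial>B \<partial>Leb N)"
      by (subst nn_integral_indicator_singleton) simp_all
    also have "\<dots> = (\<integral>\<^sup>+ z. \<integral>\<^sup>+ \<beta>. \<integral>\<^sup>+ w. (ennreal (gauss N (s1 + s2) (X \<beta>) z) * indicator {w} (W \<beta>)) * indicator S (w, z)
        \<partial>count_space UNIV \<partial>B \<partial>Leb N)"
      by (intro nn_integral_cong) (auto simp: indicator_def)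
    also have "\<dots> = (\<integral>\<^sup>+ z. \<integral>\<^sup>+ w. \<integral>\<^sup>+ \<beta>. (ennreal (gauss N (s1 + s2) (X \<beta>) z) * indicator {w} (W \<beta>)) * indicator S (w, z)
        \<partial>B \<partial>count_space UNIV \<partial>Leb N)"
      by (intro nn_integral_cong CB.Fubini') measurable
    also have "\<dots> = (\<integral>\<^sup>+ z. \<integral>\<^sup>+ w. ennreal (pWZ w z) * indicator S (w, z) \<partial>count_space UNIV \<partial>Leb N)"
      by (simp add: nn_integral_multc ennreal_pWZ)
    also have "\<dots> = emeasure ?E S"
      by (subst emeasure_density) (auto simp: CL.nn_integral_snd[symmetric] split_beta')
    finally show "emeasure ?D S = emeasure ?E S" .
  qed simp
qed simp_all

text \<open>Expresses the entropy as an expectation over the experiment, where it can be combined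
  with the other log densities. No integrability is assumed; the divergent case is treated where the
  identity is applied.\<close>

lemma conditional_entropy_eq:
  "conditional_entropy 2 (count_space UNIV) (Leb N) (\<lambda>\<omega>. W (b \<omega>)) Z =
    - expectation (\<lambda>\<omega>. log 2 (pWZ (W (b \<omega>)) (Z \<omega>) / pZ (Z \<omega>)))"
proof -
  interpret I: information_space M 2 by standard simp
  have "conditional_entropy 2 (count_space UNIV) (Leb N) (\<lambda>\<omega>. W (b \<omega>)) Z =
    - (\<integral>(w, z). pWZ (fst (w, z)) (snd (w, z)) * log 2 (pWZ (fst (w, z)) (snd (w, z)) / pZ z) \<partial>(count_space UNIV \<Otimes>\<^sub>M Leb N))"
    by (rule I.conditional_entropy_generic_eq[OF _ _ distributed_Z _ distributed_WZ])
       (auto intro: sigma_finite_measure_count_space sigma_finite_Leb)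
  also have "\<dots> = - (\<integral>p. pWZ (fst p) (snd p) * (case p of (w, z) \<Rightarrow> log 2 (pWZ w z / pZ z)) \<partial>(count_space UNIV \<Otimes>\<^sub>M Leb N))"
    by (simp add: split_beta')
  also have "\<dots> = - expectation (\<lambda>\<omega>. case (W (b \<omega>), Z \<omega>) of (w, z) \<Rightarrow> log 2 (pWZ w z / pZ z))"
    by (subst distributed_integral[OF distributed_WZ]) auto
  finally show ?thesis by simp
qed

text \<open>A density is positive almost surely under the law that it defines.\<close>

lemma pWZ_pos: "AE \<omega> in M. 0 < pWZ (W (b \<omega>)) (Z \<omega>)"
  using distributed_AE2[OF distributed_WZ, of "\<lambda>p. 0 < pWZ (fst p) (snd p)"] by simp

text \<open>The denominators \<open>p(Y|X)\<close> and \<open>p(Z|Y)\<close> cancel the channel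
  density. Averaging \<open>p(Z|X)\<close> over the inputs that carry message \<open>w\<close> then
  produces \<open>pWZ w z\<close>, which cancels as well. What remains is \<open>\<kappa>\<close>,
  of total mass at most 1 over the messages, a Gaussian density in \<open>y\<close>, and the density
  \<open>pZ\<close>.\<close>

lemma nn_tilted_le_1:
  fixes \<kappa> :: "'w \<Rightarrow> (nat \<Rightarrow> real) \<Rightarrow> real" and a \<tau> :: real
  assumes [measurable]: "case_prod \<kappa> \<in> borel_measurable (count_space UNIV \<Otimes>\<^sub>M Leb N)"
    and nn: "\<And>w y. 0 \<le> \<kappa> w y" and sum: "\<And>y. (\<Sum>w\<in>A. \<kappa> w y) \<le> 1" and \<tau>: "\<tau> > 0"
  shows "(\<integral>\<^sup>+ \<omega>. ennreal (\<kappa> (W (b \<omega>)) (Y \<omega>) * gauss N \<tau> (\<lambda>i. a * Z \<omega> i) (Y \<omega>) * pZ (Z \<omega>) * gauss N (s1 + s2) (X (b \<omega>)) (Z \<omega>)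
     / (pWZ (W (b \<omega>)) (Z \<omega>) * gauss N s1 (X (b \<omega>)) (Y \<omega>) * gauss N s2 (Y \<omega>) (Z \<omega>))) \<partial>M) \<le> 1"
proof -
  let ?T = "\<lambda>\<beta> y z. \<kappa> (W \<beta>) y * gauss N \<tau> (\<lambda>i. a * z i) y * pZ z * gauss N (s1 + s2) (X \<beta>) z
     / (pWZ (W \<beta>) z * gauss N s1 (X \<beta>) y * gauss N s2 y z)"
  \<comment> \<open>The factors that depend on the input once the channel density has been
    cancelled.\<close>
  let ?h = "\<lambda>\<beta> y z. \<kappa> (W \<beta>) y * gauss N (s1 + s2) (X \<beta>) z / pWZ (W \<beta>) z"
  have inner: "(\<integral>\<^sup>+ \<beta>. ennreal (?h \<beta> y z) \<partial>B) \<le> 1" if [measurable]: "y \<in> space (Leb N)" "z \<in> space (Leb N)" for y z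
  proof -
    have "(\<integral>\<^sup>+ \<beta>. ennreal (?h \<beta> y z) \<partial>B) =
      (\<integral>\<^sup>+ \<beta>. (\<Sum>w\<in>A. ennreal (\<kappa> w y / pWZ w z) * (ennreal (gauss N (s1 + s2) (X \<beta>) z) * indicator {w} (W \<beta>))) \<partial>B)"
    proof (intro nn_integral_cong)
      fix \<beta> assume "\<beta> \<in> space B"
      then have "(\<Sum>w\<in>A. ennreal (\<kappa> w y / pWZ w z) * (ennreal (gauss N (s1 + s2) (X \<beta>) z) * indicator {w} (W \<beta>)))
         = (\<Sum>w\<in>{W \<beta>}. ennreal (\<kappa> w y / pWZ w z) * (ennreal (gauss N (s1 + s2) (X \<beta>) z) * indicator {w} (W \<beta>)))"
        using W_A fin_A by (intro sum.mono_neutral_right) auto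
      then show "ennreal (?h \<beta> y z) = (\<Sum>w\<in>A. ennreal (\<kappa> w y / pWZ w z) * (ennreal (gauss N (s1 + s2) (X \<beta>) z) * indicator {w} (W \<beta>)))"
        using nn by (simp add: ennreal_mult[symmetric])
    qed
    also have "\<dots> = (\<Sum>w\<in>A. ennreal (\<kappa> w y / pWZ w z) * ennreal (pWZ w z))"
      by (simp add: nn_integral_sum nn_integral_cmult ennreal_pWZ)
    \<comment> \<open>Only an inequality: where \<open>pWZ w z = 0\<close> the quotient is 0 by
      convention and the summand disappears.\<close>
    also have "\<dots> \<le> (\<Sum>w\<in>A. ennreal (\<kappa> w y))"
      using nn by (intro sum_mono) (auto simp: ennreal_mult[symmetric])
    also have "\<dots> \<le> 1"
      using nn sum[of y] by (simp add: sum_ennreal)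
    finally show ?thesis .
  qed
  have "(\<integral>\<^sup>+ \<omega>. ennreal (?T (b \<omega>) (Y \<omega>) (Z \<omega>)) \<partial>M) =
    (\<integral>\<^sup>+ \<beta>. \<integral>\<^sup>+ y. \<integral>\<^sup>+ z. ennreal (gauss N s1 (X \<beta>) y) * ennreal (gauss N s2 y z) * ennreal (?T \<beta> y z) \<partial>Leb N \<partial>Leb N \<partial>B)"
    by (rule nn_joint) measurable
  also have "\<dots> = (\<integral>\<^sup>+ \<beta>. \<integral>\<^sup>+ y. \<integral>\<^sup>+ z. ennreal (gauss N \<tau> (\<lambda>i. a * z i) y) * ennreal (pZ z) * ennreal (?h \<beta> y z) \<partial>Leb N \<partial>Leb N \<partial>B)"
  proof (intro nn_integral_cong)
    fix \<beta> y z
    show "ennreal (gauss N s1 (X \<beta>) y) * ennreal (gauss N s2 y z) * ennreal (?T \<beta> y z)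
      = ennreal (gauss N \<tau> (\<lambda>i. a * z i) y) * ennreal (pZ z) * ennreal (?h \<beta> y z)"
      using gauss_pos[OF s1_pos, of N "X \<beta>" y] gauss_pos[OF s2_pos, of N y z] nn
      by (simp add: ennreal_mult[symmetric] field_simps)
  qed
  \<comment> \<open>The input becomes the innermost variable, so that \<open>inner\<close> applies
    for fixed \<open>y\<close> and \<open>z\<close>.\<close>
  also have "\<dots> = (\<integral>\<^sup>+ z. \<integral>\<^sup>+ y. \<integral>\<^sup>+ \<beta>. ennreal (gauss N \<tau> (\<lambda>i. a * z i) y) * ennreal (pZ z) * ennreal (?h \<beta> y z) \<partial>B \<partial>Leb N \<partial>Leb N)"
    by (intro swap3) measurable
  also have "\<dots> = (\<integral>\<^sup>+ z. \<integral>\<^sup>+ y. ennreal (gauss N \<tau> (\<lambda>i. a * z i) y) * ennreal (pZ z) * (\<integral>\<^sup>+ \<beta>. ennreal (?h \<beta> y z) \<partial>B) \<partial>Leb N \<partial>Leb N)"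
    by (intro nn_integral_cong nn_integral_cmult) measurable
  also have "\<dots> \<le> (\<integral>\<^sup>+ z. \<integral>\<^sup>+ y. ennreal (gauss N \<tau> (\<lambda>i. a * z i) y) * ennreal (pZ z) * 1 \<partial>Leb N \<partial>Leb N)"
    by (intro nn_integral_mono mult_left_mono inner) auto
  also have "\<dots> = (\<integral>\<^sup>+ z. ennreal (pZ z) \<partial>Leb N)"
    by (intro nn_integral_cong) (simp add: nn_integral_multc nn_integral_gauss \<tau>)
  also have "\<dots> = (\<integral>\<^sup>+ z. ennreal (pZ z) * 1 \<partial>Leb N)" by simp
  also have "\<dots> = (\<integral>\<^sup>+ \<omega>. 1 \<partial>M)"
    by (rule distributed_nn_integral[OF distributed_Z]) simp
  also have "\<dots> = 1" by (simp add: emeasure_space_1)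
  finally show ?thesis .
qed

section \<open>Second moments of affine combinations of inputs and outputs\<close>

lemma nn_affine_square:
  assumes [measurable]: "V \<in> borel_measurable B" and i: "i < N"
  shows "(\<integral>\<^sup>+ \<omega>. ennreal ((V (b \<omega>) + c * Y \<omega> i + d * Z \<omega> i)\<^sup>2) \<partial>M) =
    (\<integral>\<^sup>+ \<beta>. ennreal ((V \<beta> + (c + d) * X \<beta> i)\<^sup>2) \<partial>B) + ennreal ((c + d)\<^sup>2 * s1 + d\<^sup>2 * s2)"
proof -
  have "(\<integral>\<^sup>+ \<omega>. ennreal ((V (b \<omega>) + c * Y \<omega> i + d * Z \<omega> i)\<^sup>2) \<partial>M) =
    (\<integral>\<^sup>+ \<beta>. \<integral>\<^sup>+ y. \<integral>\<^sup>+ z. ennreal (gauss N s1 (X \<beta>) y) * ennreal (gauss N s2 y z) * ennreal ((V \<beta> + c * y i + d * z i)\<^sup>2) \<partial>Leb N \<partial>Leb N \<partial>B)"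
    using i by (intro nn_joint[of "\<lambda>\<beta> y z. ennreal ((V \<beta> + c * y i + d * z i)\<^sup>2)"]) measurable
  \<comment> \<open>The second noise enters through \<open>Z\<close> alone, with coefficient
    \<open>d\<close>; the first enters through both outputs, with coefficient \<open>c + d\<close>.
    Each integration adds the noise variance times the square of that coefficient.\<close>
  also have "\<dots> = (\<integral>\<^sup>+ \<beta>. \<integral>\<^sup>+ y. ennreal (gauss N s1 (X \<beta>) y) * ennreal ((V \<beta> + (c + d) * y i)\<^sup>2 + d\<^sup>2 * s2) \<partial>Leb N \<partial>B)"
  proof (intro nn_integral_cong)
    fix \<beta> y assume "\<beta> \<in> space B" "y \<in> space (Leb N)"
    have "(\<integral>\<^sup>+ z. ennreal (gauss N s1 (X \<beta>) y) * ennreal (gauss N s2 y z) * ennreal ((V \<beta> + c * y i + d * z i)\<^sup>2) \<partial>Leb N)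
      = ennreal (gauss N s1 (X \<beta>) y) * (\<integral>\<^sup>+ z. ennreal (gauss N s2 y z) * ennreal (((V \<beta> + c * y i) + d * z i)\<^sup>2) \<partial>Leb N)"
      unfolding mult.assoc using i by (intro nn_integral_cmult) measurable
    also have "\<dots> = ennreal (gauss N s1 (X \<beta>) y) * ennreal ((V \<beta> + (c + d) * y i)\<^sup>2 + d\<^sup>2 * s2)"
      by (subst nn_integral_gauss_square[OF s2_pos i]) (simp add: algebra_simps)
    finally show "(\<integral>\<^sup>+ z. ennreal (gauss N s1 (X \<beta>) y) * ennreal (gauss N s2 y z) * ennreal ((V \<beta> + c * y i + d * z i)\<^sup>2) \<partial>Leb N)
      = \<dots>" .
  qed
  also have "\<dots> = (\<integral>\<^sup>+ \<beta>. ennreal ((V \<beta> + (c + d) * X \<beta> i)\<^sup>2) + ennreal ((c + d)\<^sup>2 * s1 + d\<^sup>2 * s2) \<partial>B)"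
  proof (intro nn_integral_cong)
    fix \<beta> assume "\<beta> \<in> space B"
    have "(\<integral>\<^sup>+ y. ennreal (gauss N s1 (X \<beta>) y) * ennreal ((V \<beta> + (c + d) * y i)\<^sup>2 + d\<^sup>2 * s2) \<partial>Leb N)
      = (\<integral>\<^sup>+ y. ennreal (gauss N s1 (X \<beta>) y) * ennreal ((V \<beta> + (c + d) * y i)\<^sup>2) + ennreal (gauss N s1 (X \<beta>) y) * ennreal (d\<^sup>2 * s2) \<partial>Leb N)"
      using s2_pos by (intro nn_integral_cong) (simp add: distrib_left)
    also have "\<dots> = ennreal ((V \<beta> + (c + d) * X \<beta> i)\<^sup>2 + (c + d)\<^sup>2 * s1) + ennreal (d\<^sup>2 * s2)"
      using i by (subst nn_integral_add)
        (simp_all add: nn_integral_gauss_square s1_pos nn_integral_multc nn_integral_gauss)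
    also have "\<dots> = ennreal ((V \<beta> + (c + d) * X \<beta> i)\<^sup>2) + ennreal ((c + d)\<^sup>2 * s1 + d\<^sup>2 * s2)"
      using s1_pos s2_pos by (simp add: ennreal_plus[symmetric] del: ennreal_plus)
    finally show "(\<integral>\<^sup>+ y. ennreal (gauss N s1 (X \<beta>) y) * ennreal ((V \<beta> + (c + d) * y i)\<^sup>2 + d\<^sup>2 * s2) \<partial>Leb N) = \<dots>" .
  qed
  also have "\<dots> = (\<integral>\<^sup>+ \<beta>. ennreal ((V \<beta> + (c + d) * X \<beta> i)\<^sup>2) \<partial>B) + ennreal ((c + d)\<^sup>2 * s1 + d\<^sup>2 * s2)"
    using i by (subst nn_integral_add) (simp_all add: B.emeasure_space_1)
  finally show ?thesis .
qed

lemma affine_square: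
  assumes [measurable]: "V \<in> borel_measurable B" and i: "i < N"
    and r: "(\<integral>\<^sup>+ \<beta>. ennreal ((V \<beta> + (c + d) * X \<beta> i)\<^sup>2) \<partial>B) = ennreal r" "r \<ge> 0"
  shows "has_bochner_integral M (\<lambda>\<omega>. (V (b \<omega>) + c * Y \<omega> i + d * Z \<omega> i)\<^sup>2) (r + (c + d)\<^sup>2 * s1 + d\<^sup>2 * s2)"
proof (rule has_bochner_integral_nn_integral)
  show "(\<integral>\<^sup>+ \<omega>. ennreal ((V (b \<omega>) + c * Y \<omega> i + d * Z \<omega> i)\<^sup>2) \<partial>M) = ennreal (r + (c + d)\<^sup>2 * s1 + d\<^sup>2 * s2)"
    using r s1_pos s2_pos by (subst nn_affine_square) (simp_all add: i ennreal_plus[symmetric] add.assoc del: ennreal_plus)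
qed (use i r s1_pos s2_pos in simp_all)

text \<open>In each difference the input cancels and pure noise is left, so these expectations are
  finite whatever the input power.\<close>

lemma noise_square:
  "has_bochner_integral M (\<lambda>\<omega>. \<Sum>i<N. (Y \<omega> i - X (b \<omega>) i)\<^sup>2) (real N * s1)"
  "has_bochner_integral M (\<lambda>\<omega>. \<Sum>i<N. (Z \<omega> i - Y \<omega> i)\<^sup>2) (real N * s2)"
  "has_bochner_integral M (\<lambda>\<omega>. \<Sum>i<N. (Z \<omega> i - X (b \<omega>) i)\<^sup>2) (real N * (s1 + s2))"
proof -
  have "has_bochner_integral M (\<lambda>\<omega>. \<Sum>i<N. (- X (b \<omega>) i + 1 * Y \<omega> i + 0 * Z \<omega> i)\<^sup>2) (\<Sum>i<N. 0 + (1 + 0)\<^sup>2 * s1 + 0\<^sup>2 * s2)"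
    by (intro has_bochner_integral_sum affine_square[of "\<lambda>\<beta>. - X \<beta> _"]) simp_all
  then show "has_bochner_integral M (\<lambda>\<omega>. \<Sum>i<N. (Y \<omega> i - X (b \<omega>) i)\<^sup>2) (real N * s1)"
    by simp
  have "has_bochner_integral M (\<lambda>\<omega>. \<Sum>i<N. (0 + (-1) * Y \<omega> i + 1 * Z \<omega> i)\<^sup>2) (\<Sum>i<N. 0 + (-1 + 1)\<^sup>2 * s1 + 1\<^sup>2 * s2)"
    by (intro has_bochner_integral_sum affine_square[of "\<lambda>\<beta>. 0"]) simp_all
  then show "has_bochner_integral M (\<lambda>\<omega>. \<Sum>i<N. (Z \<omega> i - Y \<omega> i)\<^sup>2) (real N * s2)"
    by simp
  have "has_bochner_integral M (\<lambda>\<omega>. \<Sum>i<N. (- X (b \<omega>) i + 0 * Y \<omega> i + 1 * Z \<omega> i)\<^sup>2) (\<Sum>i<N. 0 + (0 + 1)\<^sup>2 * s1 + 1\<^sup>2 * s2)"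
    by (intro has_bochner_integral_sum affine_square[of "\<lambda>\<beta>. - X \<beta> _"]) simp_all
  then show "has_bochner_integral M (\<lambda>\<omega>. \<Sum>i<N. (Z \<omega> i - X (b \<omega>) i)\<^sup>2) (real N * (s1 + s2))"
    by simp
qed

lemma expectation_ln_gauss:
  assumes "has_bochner_integral M (\<lambda>\<omega>. \<Sum>i<N. (g \<omega> i - f \<omega> i)\<^sup>2) v" and "s > 0"
  shows "has_bochner_integral M (\<lambda>\<omega>. ln (gauss N s (f \<omega>) (g \<omega>))) (- (real N / 2) * ln (2 * pi * s) - v / (2 * s))"
  unfolding ln_gauss[OF \<open>s > 0\<close>]
  using has_bochner_integral_diff[OF _ has_bochner_integral_divide_zero[OF assms(1), of "2 * s"], of "\<lambda>_. - (real N / 2) * ln (2 * pi * s)" "- (real N / 2) * ln (2 * pi * s)"]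
  by (simp add: has_bochner_integral_iff prob_space)

text \<open>The logarithmic term is \<open>N\<close> times the conditional mutual information of
  \<open>X\<close> and \<open>Y\<close> given \<open>Z\<close> for a Gaussian input of power
  \<open>Q\<close>. The test distribution \<open>\<kappa>\<close> measures how well the message can
  be guessed from \<open>Y\<close>; its expected logarithm later becomes the Fano term.\<close>

lemma conditional_entropy_le:
  fixes \<kappa> :: "'w \<Rightarrow> (nat \<Rightarrow> real) \<Rightarrow> real" and Q :: real
  assumes [measurable]: "case_prod \<kappa> \<in> borel_measurable (count_space UNIV \<Otimes>\<^sub>M Leb N)"
    and nn: "\<And>w y. 0 \<le> \<kappa> w y" and pos: "\<And>w y. w \<in> A \<Longrightarrow> 0 < \<kappa> w y" and sum: "\<And>y. (\<Sum>w\<in>A. \<kappa> w y) \<le> 1"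
    and int: "integrable M (\<lambda>\<omega>. ln (\<kappa> (W (b \<omega>)) (Y \<omega>)))"
    and e: "\<And>i. i < N \<Longrightarrow> (\<integral>\<^sup>+ \<beta>. ennreal ((X \<beta> i)\<^sup>2) \<partial>B) = ennreal (e i)" "\<And>i. i < N \<Longrightarrow> 0 \<le> e i"
    and Q: "(\<Sum>i<N. e i) \<le> real N * Q" "0 \<le> Q"
  shows "conditional_entropy 2 (count_space UNIV) (Leb N) (\<lambda>\<omega>. W (b \<omega>)) Z * ln 2 \<le>
    real N / 2 * ln ((Q + s1) * (s1 + s2) / (s1 * (Q + s1 + s2))) - expectation (\<lambda>\<omega>. ln (\<kappa> (W (b \<omega>)) (Y \<omega>)))"
proof -
  have b_space: "b \<omega> \<in> space B" if "\<omega> \<in> space M" for \<omega>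
    using measurable_space[OF bYZ_meas(1) that] .
  have Hln: "conditional_entropy 2 (count_space UNIV) (Leb N) (\<lambda>\<omega>. W (b \<omega>)) Z * ln 2 =
      - expectation (\<lambda>\<omega>. ln (pWZ (W (b \<omega>)) (Z \<omega>) / pZ (Z \<omega>)))"
    unfolding conditional_entropy_eq log_def by simp
  have \<kappa>1: "\<kappa> w y \<le> 1" if "w \<in> A" for w y
    using member_le_sum[of w A "\<lambda>w. \<kappa> w y"] that nn sum[of y] fin_A by fastforce
  have q: "Q + s1 > 0" "Q + s1 + s2 > 0" "s1 + s2 > 0" using Q s1_pos s2_pos by auto
  show ?thesis
  proof (cases "integrable M (\<lambda>\<omega>. ln (pWZ (W (b \<omega>)) (Z \<omega>) / pZ (Z \<omega>)))")
    case False
    \<comment> \<open>The Bochner integral is then 0 by convention, so the conditional entropy is 0 as well.\<close>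
    have "expectation (\<lambda>\<omega>. ln (\<kappa> (W (b \<omega>)) (Y \<omega>))) \<le> expectation (\<lambda>\<omega>. 0)"
      using int by (intro integral_mono) (auto simp: ln_le_zero_iff b_space W_A pos \<kappa>1)
    moreover have "1 \<le> (Q + s1) * (s1 + s2) / (s1 * (Q + s1 + s2))"
    proof -
      have "s1 * (Q + s1 + s2) \<le> (Q + s1) * (s1 + s2)" using Q s2_pos by (simp add: algebra_simps)
      moreover have "0 < s1 * (Q + s1 + s2)" using q s1_pos by simp
      ultimately show ?thesis by (simp add: le_divide_eq_1)
    qed
    then have "0 \<le> real N / 2 * ln ((Q + s1) * (s1 + s2) / (s1 * (Q + s1 + s2)))" by simp
    ultimately show ?thesis
      unfolding Hln using not_integrable_integral_eq[OF False] by simp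
  next
    case True
    \<comment> \<open>\<open>a\<close> is the coefficient of the linear MMSE estimate of
      \<open>Y\<close> from \<open>Z\<close> for input power \<open>Q\<close>, and
      \<open>\<tau>\<close> its error variance. The number \<open>v\<close> is the total squared
      error for the actual inputs; it is at most \<open>N * \<tau>\<close> because their average
      power is at most \<open>Q\<close>.\<close>
    define a where "a = (Q + s1) / (Q + s1 + s2)"
    define \<tau> where "\<tau> = (Q + s1) * s2 / (Q + s1 + s2)"
    define v where "v = (\<Sum>i<N. (1 - a)\<^sup>2 * e i + (1 - a)\<^sup>2 * s1 + a\<^sup>2 * s2)"
    have \<tau>_pos: "\<tau> > 0" using q s2_pos by (simp add: \<tau>_def)
    have a1: "1 - a = s2 / (Q + s1 + s2)" using q by (simp add: a_def field_simps)
    have "v = (1 - a)\<^sup>2 * (\<Sum>i<N. e i) + real N * ((1 - a)\<^sup>2 * s1 + a\<^sup>2 * s2)"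
      by (simp add: v_def sum.distrib sum_distrib_left distrib_left)
    also have "\<dots> \<le> (1 - a)\<^sup>2 * (real N * Q) + real N * ((1 - a)\<^sup>2 * s1 + a\<^sup>2 * s2)"
      using Q by (intro add_right_mono mult_left_mono) auto
    also have "\<dots> = real N * ((1 - a)\<^sup>2 * (Q + s1) + a\<^sup>2 * s2)" by (simp add: algebra_simps)
    also have "(1 - a)\<^sup>2 * (Q + s1) + a\<^sup>2 * s2 = s2 * (Q + s1) * (Q + s1 + s2) / (Q + s1 + s2)\<^sup>2"
      unfolding a1 unfolding a_def by (simp add: power_divide add_divide_distrib[symmetric] power2_eq_square algebra_simps)
    also have "\<dots> = \<tau>" using q by (simp add: \<tau>_def power2_eq_square)
    finally have v: "v \<le> real N * \<tau>" .
    have "has_bochner_integral M (\<lambda>\<omega>. \<Sum>i<N. (0 + 1 * Y \<omega> i + (- a) * Z \<omega> i)\<^sup>2)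
        (\<Sum>i<N. (1 - a)\<^sup>2 * e i + (1 + - a)\<^sup>2 * s1 + (- a)\<^sup>2 * s2)"
      using e by (intro has_bochner_integral_sum affine_square[of "\<lambda>\<beta>. 0"])
        (simp_all add: power_mult_distrib ennreal_mult nn_integral_cmult)
    then have hv: "has_bochner_integral M (\<lambda>\<omega>. \<Sum>i<N. (Y \<omega> i - a * Z \<omega> i)\<^sup>2) v"
      by (simp add: v_def)
    let ?T = "\<lambda>\<omega>. \<kappa> (W (b \<omega>)) (Y \<omega>) * gauss N \<tau> (\<lambda>i. a * Z \<omega> i) (Y \<omega>) * pZ (Z \<omega>) * gauss N (s1 + s2) (X (b \<omega>)) (Z \<omega>)
     / (pWZ (W (b \<omega>)) (Z \<omega>) * gauss N s1 (X (b \<omega>)) (Y \<omega>) * gauss N s2 (Y \<omega>) (Z \<omega>))"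
    let ?R = "\<lambda>\<omega>. ln (\<kappa> (W (b \<omega>)) (Y \<omega>)) + ln (gauss N \<tau> (\<lambda>i. a * Z \<omega> i) (Y \<omega>)) - ln (pWZ (W (b \<omega>)) (Z \<omega>) / pZ (Z \<omega>))
     + ln (gauss N (s1 + s2) (X (b \<omega>)) (Z \<omega>)) - ln (gauss N s1 (X (b \<omega>)) (Y \<omega>)) - ln (gauss N s2 (Y \<omega>) (Z \<omega>))"
    let ?r = "expectation (\<lambda>\<omega>. ln (\<kappa> (W (b \<omega>)) (Y \<omega>))) + (- (real N / 2) * ln (2 * pi * \<tau>) - v / (2 * \<tau>))
      - expectation (\<lambda>\<omega>. ln (pWZ (W (b \<omega>)) (Z \<omega>) / pZ (Z \<omega>)))
      + (- (real N / 2) * ln (2 * pi * (s1 + s2)) - (real N * (s1 + s2)) / (2 * (s1 + s2)))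
      - (- (real N / 2) * ln (2 * pi * s1) - (real N * s1) / (2 * s1)) - (- (real N / 2) * ln (2 * pi * s2) - (real N * s2) / (2 * s2))"
    have R: "has_bochner_integral M ?R ?r"
      using int True s1_pos s2_pos \<tau>_pos hv noise_square q
      by (intro has_bochner_integral_diff has_bochner_integral_add expectation_ln_gauss has_bochner_integral_integrable) auto
    \<comment> \<open>Since \<open>pWZ\<close> is known to be positive only almost surely, both the
      positivity of \<open>?T\<close> and the splitting of its logarithm are stated almost
      everywhere.\<close>
    have T: "AE \<omega> in M. ?T \<omega> > 0 \<and> ln (?T \<omega>) = ?R \<omega>"
      using pWZ_pos AE_space
    proof eventually_elim
      case (elim \<omega>)
      have ln_quot: "0 < k * r * p * g / (q * g1 * g2) \<and>
          ln (k * r * p * g / (q * g1 * g2)) = ln k + ln r - ln (q / p) + ln g - ln g1 - ln g2"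
        if "0 < k" "0 < r" "0 < p" "0 < g" "0 < q" "0 < g1" "0 < g2" for k r p g q g1 g2 :: real
        using that by (simp add: ln_mult ln_div)
      show ?case
        using elim q s1_pos s2_pos \<tau>_pos
        by (intro ln_quot) (auto intro!: gauss_pos pos W_A b_space pZ_pos)
    qed
    have [measurable]: "?T \<in> borel_measurable M" by measurable
    have "expectation (\<lambda>\<omega>. ln (?T \<omega>)) \<le> 0"
    proof (rule gibbs)
      show "AE \<omega> in M. 0 < ?T \<omega>" using T by auto
      show "(\<integral>\<^sup>+ \<omega>. ennreal (?T \<omega>) \<partial>M) \<le> 1"
        by (rule nn_tilted_le_1) (use nn sum \<tau>_pos in auto)
      show "integrable M (\<lambda>\<omega>. ln (?T \<omega>))"
        using R T by (subst integrable_cong_AE[of _ _ ?R]) (auto simp: has_bochner_integral_iff)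
    qed measurable
    also have "expectation (\<lambda>\<omega>. ln (?T \<omega>)) = expectation ?R"
      using R T by (intro integral_cong_AE) (auto simp: has_bochner_integral_iff)
    also have "\<dots> = ?r" using R by (simp add: has_bochner_integral_iff)
    finally have "?r \<le> 0" .
    moreover have "v / (2 * \<tau>) \<le> real N / 2" using v \<tau>_pos by (simp add: field_simps)
    moreover have "ln ((Q + s1) * (s1 + s2) / (s1 * (Q + s1 + s2))) =
      ln (2 * pi * \<tau>) + ln (2 * pi * (s1 + s2)) - ln (2 * pi * s1) - ln (2 * pi * s2)"
      using q s1_pos s2_pos by (simp add: \<tau>_def ln_mult ln_div)
    then have "real N / 2 * ln ((Q + s1) * (s1 + s2) / (s1 * (Q + s1 + s2))) =
      real N / 2 * ln (2 * pi * \<tau>) + real N / 2 * ln (2 * pi * (s1 + s2))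
      - real N / 2 * ln (2 * pi * s1) - real N / 2 * ln (2 * pi * s2)"
      by (simp add: right_diff_distrib distrib_left)
    moreover have half: "real N * s / (2 * s) = real N / 2" if "0 < s" for s using that by simp
    note half[OF q(3)] half[OF s1_pos] half[OF s2_pos]
    ultimately show ?thesis unfolding Hln by linarith
  qed
qed

text \<open>Gibbs' inequality with \<open>T = \<kappa> r(Y|V) / p(Y|X)\<close>, where
  \<open>r\<close> is the Gaussian of variance \<open>\<tau>\<close> about the prediction
  \<open>V\<close>. As \<open>\<tau>\<close> dominates the average squared error of that prediction,
  only \<open>ln (\<tau> / s1)\<close> survives. The normalisation \<open>le1\<close> is a
  hypothesis because it will rest on the independence of the second message and the first signal, a
  structure that the abstract input space does not have.\<close>

lemma expectation_ln_le:
  fixes \<kappa> :: "'b \<Rightarrow> (nat \<Rightarrow> real) \<Rightarrow> real" and V :: "'b \<Rightarrow> nat \<Rightarrow> real"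
  assumes [measurable]: "case_prod \<kappa> \<in> borel_measurable (B \<Otimes>\<^sub>M Leb N)"
    and V: "\<And>i. i < N \<Longrightarrow> (\<lambda>\<beta>. V \<beta> i) \<in> borel_measurable B"
    and pos: "\<And>\<beta> y. \<beta> \<in> space B \<Longrightarrow> 0 < \<kappa> \<beta> y"
    and int: "integrable M (\<lambda>\<omega>. ln (\<kappa> (b \<omega>) (Y \<omega>)))"
    and e: "\<And>i. i < N \<Longrightarrow> (\<integral>\<^sup>+ \<beta>. ennreal ((X \<beta> i - V \<beta> i)\<^sup>2) \<partial>B) = ennreal (e i)" "\<And>i. i < N \<Longrightarrow> 0 \<le> e i"
    and \<tau>: "(\<Sum>i<N. e i) + real N * s1 \<le> real N * \<tau>" "0 < \<tau>"
    and le1: "(\<integral>\<^sup>+ \<beta>. \<integral>\<^sup>+ y. ennreal (\<kappa> \<beta> y * gauss N \<tau> (V \<beta>) y) \<partial>Leb N \<partial>B) \<le> 1"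
  shows "expectation (\<lambda>\<omega>. ln (\<kappa> (b \<omega>) (Y \<omega>))) \<le> real N / 2 * ln (\<tau> / s1)"
proof -
  have V2 [measurable]: "i < N \<Longrightarrow> (\<lambda>\<omega>. V (b \<omega>) i) \<in> borel_measurable M" for i
    using measurable_compose[OF bYZ_meas(1) V[of i]] by simp
  have V3 [measurable]: "i < N \<Longrightarrow> (\<lambda>p. V (fst p) i) \<in> borel_measurable (B \<Otimes>\<^sub>M Leb N \<Otimes>\<^sub>M Leb N)" for i
    using measurable_compose[OF measurable_fst V[of i]] by simp
  \<comment> \<open>The coefficients \<open>1 + 0\<close> and \<open>0\<close> are those of
    \<open>affine_square\<close> for a combination that contains \<open>Y\<close> once and
    \<open>Z\<close> not at all.\<close>
  define v where "v = (\<Sum>i<N. e i + (1 + 0)\<^sup>2 * s1 + 0\<^sup>2 * s2)"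
  have v: "v \<le> real N * \<tau>" using \<tau> by (simp add: v_def sum.distrib)
  have "has_bochner_integral M (\<lambda>\<omega>. \<Sum>i<N. (- V (b \<omega>) i + 1 * Y \<omega> i + 0 * Z \<omega> i)\<^sup>2) v"
    unfolding v_def using V e
    by (intro has_bochner_integral_sum affine_square[of "\<lambda>\<beta>. - V \<beta> _"]) simp_all
  then have hv: "has_bochner_integral M (\<lambda>\<omega>. \<Sum>i<N. (Y \<omega> i - V (b \<omega>) i)\<^sup>2) v" by simp
  let ?T = "\<lambda>\<omega>. \<kappa> (b \<omega>) (Y \<omega>) * gauss N \<tau> (V (b \<omega>)) (Y \<omega>) / gauss N s1 (X (b \<omega>)) (Y \<omega>)"
  let ?R = "\<lambda>\<omega>. ln (\<kappa> (b \<omega>) (Y \<omega>)) + ln (gauss N \<tau> (V (b \<omega>)) (Y \<omega>)) - ln (gauss N s1 (X (b \<omega>)) (Y \<omega>))"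
  let ?r = "expectation (\<lambda>\<omega>. ln (\<kappa> (b \<omega>) (Y \<omega>))) + (- (real N / 2) * ln (2 * pi * \<tau>) - v / (2 * \<tau>))
      - (- (real N / 2) * ln (2 * pi * s1) - (real N * s1) / (2 * s1))"
  have R: "has_bochner_integral M ?R ?r"
    using int s1_pos \<tau> hv noise_square(1)
    by (intro has_bochner_integral_diff has_bochner_integral_add expectation_ln_gauss has_bochner_integral_integrable) auto
  have T: "?T \<omega> > 0 \<and> ln (?T \<omega>) = ?R \<omega>" if "\<omega> \<in> space M" for \<omega>
    using pos[OF measurable_space[OF bYZ_meas(1) that], of "Y \<omega>"] gauss_pos[OF s1_pos, of N "X (b \<omega>)" "Y \<omega>"]
      gauss_pos[OF \<tau>(2), of N "V (b \<omega>)" "Y \<omega>"]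
    by (simp add: ln_mult ln_div)
  have "expectation (\<lambda>\<omega>. ln (?T \<omega>)) \<le> 0"
  proof (rule gibbs)
    show "AE \<omega> in M. 0 < ?T \<omega>" using T by (intro AE_I2) auto
    show "integrable M (\<lambda>\<omega>. ln (?T \<omega>))"
      using R T by (subst Bochner_Integration.integrable_cong[of _ _ _ ?R]) (auto simp: has_bochner_integral_iff)
    have "(\<integral>\<^sup>+ \<omega>. ennreal (?T \<omega>) \<partial>M) = (\<integral>\<^sup>+ \<beta>. \<integral>\<^sup>+ y. \<integral>\<^sup>+ z. ennreal (gauss N s1 (X \<beta>) y) * ennreal (gauss N s2 y z) *
        ennreal (\<kappa> \<beta> y * gauss N \<tau> (V \<beta>) y / gauss N s1 (X \<beta>) y) \<partial>Leb N \<partial>Leb N \<partial>B)"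
      by (rule nn_joint) (simp add: split_beta')
    also have "\<dots> = (\<integral>\<^sup>+ \<beta>. \<integral>\<^sup>+ y. ennreal (\<kappa> \<beta> y * gauss N \<tau> (V \<beta>) y) \<partial>Leb N \<partial>B)"
    proof (intro nn_integral_cong)
      fix \<beta> y assume "\<beta> \<in> space B" "y \<in> space (Leb N)"
      have "(\<integral>\<^sup>+ z. ennreal (gauss N s1 (X \<beta>) y) * ennreal (gauss N s2 y z) *
          ennreal (\<kappa> \<beta> y * gauss N \<tau> (V \<beta>) y / gauss N s1 (X \<beta>) y) \<partial>Leb N) =
          (\<integral>\<^sup>+ z. ennreal (\<kappa> \<beta> y * gauss N \<tau> (V \<beta>) y) * ennreal (gauss N s2 y z) \<partial>Leb N)"
        using gauss_pos[OF s1_pos, of N "X \<beta>" y] pos[OF \<open>\<beta> \<in> space B\<close>, of y]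
        by (intro nn_integral_cong) (simp add: ennreal_mult[symmetric])
      also have "\<dots> = ennreal (\<kappa> \<beta> y * gauss N \<tau> (V \<beta>) y)"
        by (simp add: nn_integral_cmult nn_integral_gauss s2_pos)
      finally show "(\<integral>\<^sup>+ z. ennreal (gauss N s1 (X \<beta>) y) * ennreal (gauss N s2 y z) *
          ennreal (\<kappa> \<beta> y * gauss N \<tau> (V \<beta>) y / gauss N s1 (X \<beta>) y) \<partial>Leb N) = \<dots>" .
    qed
    finally show "(\<integral>\<^sup>+ \<omega>. ennreal (?T \<omega>) \<partial>M) \<le> 1" using le1 by simp
  qed measurable
  also have "expectation (\<lambda>\<omega>. ln (?T \<omega>)) = expectation ?R"
    using T by (intro Bochner_Integration.integral_cong) auto
  also have "\<dots> = ?r" using R by (simp add: has_bochner_integral_iff)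
  finally have "?r \<le> 0" .
  moreover have "v / (2 * \<tau>) \<le> real N / 2" using v \<tau> by (simp add: field_simps)
  moreover have "ln (\<tau> / s1) = ln (2 * pi * \<tau>) - ln (2 * pi * s1)"
    using \<tau> s1_pos by (simp add: ln_mult ln_div)
  then have "real N / 2 * ln (\<tau> / s1) = real N / 2 * ln (2 * pi * \<tau>) - real N / 2 * ln (2 * pi * s1)"
    by (simp add: right_diff_distrib)
  moreover have "(real N * s1) / (2 * s1) = real N / 2" using s1_pos by simp
  ultimately show ?thesis by linarith
qed

end

section \<open>The experiment of a wiretap code\<close>

lemma prob_space_seed: "prob_space seed_space"
  unfolding seed_space_def by (intro prob_space_uniform_measure) auto

lemma sets_seed [measurable_cong]: "sets seed_space = sets borel"
  by (simp add: seed_space_def)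

lemma prob_space_noise: "s > 0 \<Longrightarrow> prob_space (noise_space N s)"
  unfolding noise_space_def by (intro prob_space_PiM prob_space_normal_density) simp

lemma sets_noise [measurable_cong]: "sets (noise_space N s) = sets (Leb N)"
  unfolding noise_space_def by (intro sets_PiM_cong) auto

lemma nn_integral_uniform_count:
  assumes "M \<ge> 1"
  shows "(\<integral>\<^sup>+ w. f w \<partial>uniform_count_measure {1..M}) = ennreal (1 / real M) * (\<Sum>w\<in>{1..M}. f w)"
  unfolding uniform_count_measure_def using assms
  by (subst nn_integral_point_measure_finite) (auto simp: sum_distrib_left mult.commute)

text \<open>The experiment stripped of its noises; it serves as the input space \<open>B\<close> of
  the channel locale.\<close>

definition input_space :: "nat \<Rightarrow> nat \<Rightarrow> (nat \<times> nat \<times> real \<times> real) measure" where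
  "input_space M1 M2 = uniform_count_measure {1..M1} \<Otimes>\<^sub>M uniform_count_measure {1..M2} \<Otimes>\<^sub>M seed_space \<Otimes>\<^sub>M seed_space"

fun input :: "nat \<times> nat \<times> real \<times> real \<times> (nat \<Rightarrow> real) \<times> (nat \<Rightarrow> real) \<Rightarrow> nat \<times> nat \<times> real \<times> real" where
  "input (w1, w2, u1, u2, n1, n2) = (w1, w2, u1, u2)"

fun message :: "nat \<times> nat \<times> real \<times> real \<Rightarrow> nat \<times> nat" where
  "message (w1, w2, u1, u2) = (w1, w2)"

fun signal1 :: "(nat \<Rightarrow> real \<Rightarrow> nat \<Rightarrow> real) \<Rightarrow> nat \<times> nat \<times> real \<times> real \<Rightarrow> nat \<Rightarrow> real" where
  "signal1 f1 (w1, w2, u1, u2) = f1 w1 u1"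

fun signal2 :: "(nat \<Rightarrow> nat \<Rightarrow> real \<Rightarrow> nat \<Rightarrow> real) \<Rightarrow> nat \<times> nat \<times> real \<times> real \<Rightarrow> nat \<Rightarrow> real" where
  "signal2 f2 (w1, w2, u1, u2) = f2 w1 w2 u2"

definition signal where
  "signal f1 f2 \<beta> i = signal1 f1 \<beta> i + signal2 f2 \<beta> i"

locale wiretap_code =
  fixes N M1 M2 :: nat and P1 P2 s1 s2 :: real
    and f1 :: "nat \<Rightarrow> real \<Rightarrow> nat \<Rightarrow> real" and f2 :: "nat \<Rightarrow> nat \<Rightarrow> real \<Rightarrow> nat \<Rightarrow> real"
    and \<psi> :: "(nat \<Rightarrow> real) \<Rightarrow> nat \<times> nat"
  assumes valid: "valid_code N M1 M2 P1 P2 s1 s2 f1 f2 \<psi>"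
    and N_pos: "N > 0" and P1_pos: "P1 > 0" and P2_pos: "P2 > 0" and s1_pos: "s1 > 0" and s2_pos: "s2 > 0"
begin

section \<open>Iterated integrals over the factors of the experiment\<close>

lemma M_ge1: "M1 \<ge> 1" "M2 \<ge> 1"
  using valid by (auto simp: valid_code_def)

lemma f_meas [measurable]:
  "(\<lambda>u. f1 w1 u i) \<in> borel_measurable borel" "(\<lambda>u. f2 w1 w2 u i) \<in> borel_measurable borel"
  using valid by (auto simp: valid_code_def)

lemma psi_meas [measurable]: "\<psi> \<in> Leb N \<rightarrow>\<^sub>M count_space UNIV"
proof -
  have "sets (Leb N) = sets (PiM {..<N} (\<lambda>_. borel))" by (intro sets_PiM_cong) auto
  then have "Leb N \<rightarrow>\<^sub>M count_space UNIV = PiM {..<N} (\<lambda>_. borel) \<rightarrow>\<^sub>M (count_space UNIV :: (nat \<times> nat) measure)"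
    by (rule measurable_cong_sets) simp
  then show ?thesis using valid by (simp add: valid_code_def)
qed

sublocale C1: prob_space "uniform_count_measure {1..M1}"
  using M_ge1 by (intro prob_space_uniform_count_measure) auto
sublocale C2: prob_space "uniform_count_measure {1..M2}"
  using M_ge1 by (intro prob_space_uniform_count_measure) auto
sublocale SE: prob_space seed_space by (rule prob_space_seed)
sublocale N1: prob_space "noise_space N s1" by (rule prob_space_noise[OF s1_pos])
sublocale N2: prob_space "noise_space N s2" by (rule prob_space_noise[OF s2_pos])
text \<open>These pairs follow the right-nested products of \<open>exp_space\<close> and
  \<open>input_space\<close>, so that Tonelli can peel off one factor at a time.\<close>

sublocale N12: pair_prob_space "noise_space N s1" "noise_space N s2" ..
sublocale SN: pair_prob_space seed_space "noise_space N s1 \<Otimes>\<^sub>M noise_space N s2" ..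
sublocale SSN: pair_prob_space seed_space "seed_space \<Otimes>\<^sub>M noise_space N s1 \<Otimes>\<^sub>M noise_space N s2" ..
sublocale CSSN: pair_prob_space "uniform_count_measure {1..M2}" "seed_space \<Otimes>\<^sub>M seed_space \<Otimes>\<^sub>M noise_space N s1 \<Otimes>\<^sub>M noise_space N s2" ..
sublocale CCSSN: pair_prob_space "uniform_count_measure {1..M1}" "uniform_count_measure {1..M2} \<Otimes>\<^sub>M seed_space \<Otimes>\<^sub>M seed_space \<Otimes>\<^sub>M noise_space N s1 \<Otimes>\<^sub>M noise_space N s2" ..
sublocale SS: pair_prob_space seed_space seed_space ..
sublocale CSS: pair_prob_space "uniform_count_measure {1..M2}" "seed_space \<Otimes>\<^sub>M seed_space" ..
sublocale CCSS: pair_prob_space "uniform_count_measure {1..M1}" "uniform_count_measure {1..M2} \<Otimes>\<^sub>M seed_space \<Otimes>\<^sub>M seed_space" ..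

abbreviation "Exp \<equiv> exp_space N M1 M2 s1 s2"
abbreviation "Inp \<equiv> input_space M1 M2"

lemma prob_space_Exp: "prob_space Exp"
  unfolding exp_space_def by (rule CCSSN.P.prob_space_axioms)

lemma prob_space_Inp: "prob_space Inp"
  unfolding input_space_def by (rule CCSS.P.prob_space_axioms)

lemma nn_Exp:
  assumes "F \<in> borel_measurable Exp"
  shows "(\<integral>\<^sup>+ \<omega>. F \<omega> \<partial>Exp) = (\<integral>\<^sup>+ w1. \<integral>\<^sup>+ w2. \<integral>\<^sup>+ u1. \<integral>\<^sup>+ u2. \<integral>\<^sup>+ n1. \<integral>\<^sup>+ n2. F (w1, w2, u1, u2, n1, n2)
    \<partial>noise_space N s2 \<partial>noise_space N s1 \<partial>seed_space \<partial>seed_space \<partial>uniform_count_measure {1..M2} \<partial>uniform_count_measure {1..M1})"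
proof -
  note [measurable] = assms[unfolded exp_space_def]
  show ?thesis
    unfolding exp_space_def
    apply (subst CSSN.P.nn_integral_fst[symmetric], measurable)
    apply (intro nn_integral_cong)
    apply (subst SSN.P.nn_integral_fst[symmetric], measurable)
    apply (intro nn_integral_cong)
    apply (subst SN.P.nn_integral_fst[symmetric], measurable)
    apply (intro nn_integral_cong)
    apply (subst N12.P.nn_integral_fst[symmetric], measurable)
    apply (intro nn_integral_cong)
    apply (subst N2.nn_integral_fst[symmetric], measurable)
    done
qed

lemma nn_Inp:
  assumes "F \<in> borel_measurable Inp"
  shows "(\<integral>\<^sup>+ \<omega>. F \<omega> \<partial>Inp) = (\<integral>\<^sup>+ w1. \<integral>\<^sup>+ w2. \<integral>\<^sup>+ u1. \<integral>\<^sup>+ u2. F (w1, w2, u1, u2)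
    \<partial>seed_space \<partial>seed_space \<partial>uniform_count_measure {1..M2} \<partial>uniform_count_measure {1..M1})"
proof -
  note [measurable] = assms[unfolded input_space_def]
  show ?thesis
    unfolding input_space_def
    apply (subst CSS.P.nn_integral_fst[symmetric], measurable)
    apply (intro nn_integral_cong)
    apply (subst SS.P.nn_integral_fst[symmetric], measurable)
    apply (intro nn_integral_cong)
    apply (subst SE.nn_integral_fst[symmetric], measurable)
    done
qed

section \<open>Measurability of messages, signals and channel outputs\<close>

lemma coord_meas [measurable]:
  "fst \<in> Inp \<rightarrow>\<^sub>M count_space UNIV"
  "(\<lambda>\<beta>. fst (snd \<beta>)) \<in> Inp \<rightarrow>\<^sub>M count_space UNIV"
  "(\<lambda>\<beta>. fst (snd (snd \<beta>))) \<in> borel_measurable Inp"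
  "(\<lambda>\<beta>. snd (snd (snd \<beta>))) \<in> borel_measurable Inp"
proof -
  have [measurable]: "(\<lambda>w. w) \<in> uniform_count_measure A \<rightarrow>\<^sub>M count_space UNIV" for A :: "nat set"
    by (simp add: measurable_def sets_uniform_count_measure space_uniform_count_measure)
  show "fst \<in> Inp \<rightarrow>\<^sub>M count_space UNIV"
    unfolding input_space_def by (rule measurable_compose[OF measurable_fst, of "\<lambda>w. w"]) measurable
  show "(\<lambda>\<beta>. fst (snd \<beta>)) \<in> Inp \<rightarrow>\<^sub>M count_space UNIV"
    unfolding input_space_def
    by (rule measurable_compose[OF measurable_compose[OF measurable_snd measurable_fst], of "\<lambda>w. w"]) measurable
  show "(\<lambda>\<beta>. fst (snd (snd \<beta>))) \<in> borel_measurable Inp" "(\<lambda>\<beta>. snd (snd (snd \<beta>))) \<in> borel_measurable Inp"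
    unfolding input_space_def by measurable
qed

lemma message_meas [measurable]: "message \<in> Inp \<rightarrow>\<^sub>M count_space UNIV"
proof -
  have "(\<lambda>\<beta>. (fst \<beta>, fst (snd \<beta>))) \<in> Inp \<rightarrow>\<^sub>M count_space UNIV \<Otimes>\<^sub>M count_space UNIV"
    by measurable
  moreover have "message = (\<lambda>\<beta>. (fst \<beta>, fst (snd \<beta>)))" by auto
  moreover have "count_space UNIV \<Otimes>\<^sub>M count_space UNIV = (count_space UNIV :: (nat \<times> nat) measure)"
    by (subst pair_measure_countable) auto
  ultimately show ?thesis by simp
qed

text \<open>There are countably many messages, so measurability in the seed for each fixed message
  gives joint measurability.\<close>

lemma signal1_meas [measurable]: "(\<lambda>\<beta>. signal1 f1 \<beta> i) \<in> borel_measurable Inp"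
proof -
  have "(\<lambda>\<beta>. f1 (fst \<beta>) (fst (snd (snd \<beta>))) i) \<in> borel_measurable Inp"
    by (rule measurable_compose_countable'[where f="\<lambda>w \<beta>. f1 w (fst (snd (snd \<beta>))) i" and g=fst and I=UNIV]) simp_all
  moreover have "(\<lambda>\<beta>. signal1 f1 \<beta> i) = (\<lambda>\<beta>. f1 (fst \<beta>) (fst (snd (snd \<beta>))) i)" by auto
  ultimately show ?thesis by simp
qed

lemma signal2_meas [measurable]: "(\<lambda>\<beta>. signal2 f2 \<beta> i) \<in> borel_measurable Inp"
proof -
  have "(\<lambda>\<beta>. f2 (fst (message \<beta>)) (snd (message \<beta>)) (snd (snd (snd \<beta>))) i) \<in> borel_measurable Inp"
    by (rule measurable_compose_countable'[where f="\<lambda>w \<beta>. f2 (fst w) (snd w) (snd (snd (snd \<beta>))) i" and g=message and I=UNIV]) simp_all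
  moreover have "(\<lambda>\<beta>. signal2 f2 \<beta> i) = (\<lambda>\<beta>. f2 (fst (message \<beta>)) (snd (message \<beta>)) (snd (snd (snd \<beta>))) i)" by auto
  ultimately show ?thesis by simp
qed

lemma input_meas [measurable]: "input \<in> Exp \<rightarrow>\<^sub>M Inp"
proof -
  have "input = (\<lambda>\<omega>. (fst \<omega>, fst (snd \<omega>), fst (snd (snd \<omega>)), fst (snd (snd (snd \<omega>)))))" by auto
  moreover have "\<dots> \<in> Exp \<rightarrow>\<^sub>M Inp"
    unfolding input_space_def exp_space_def by measurable
  ultimately show ?thesis by simp
qed

lemma signal_meas [measurable]: "(\<lambda>\<beta>. signal f1 f2 \<beta> i) \<in> borel_measurable Inp"
  unfolding signal_def by measurable

lemma chan_Y_eq: "chan_Y N f1 f2 \<omega> = (\<lambda>i\<in>{..<N}. signal f1 f2 (input \<omega>) i + fst (snd (snd (snd (snd \<omega>)))) i)"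
  by (cases \<omega> rule: input.cases) (simp add: chan_Y_def signal_def)

lemma chan_Z_eq: "chan_Z N f1 f2 \<omega> = (\<lambda>i\<in>{..<N}. signal f1 f2 (input \<omega>) i + fst (snd (snd (snd (snd \<omega>)))) i + snd (snd (snd (snd (snd \<omega>)))) i)"
  by (cases \<omega> rule: input.cases) (simp add: chan_Z_def signal_def)

lemma noise_meas [measurable]:
  "i < N \<Longrightarrow> (\<lambda>\<omega>. fst (snd (snd (snd (snd \<omega>)))) i) \<in> borel_measurable Exp"
  "i < N \<Longrightarrow> (\<lambda>\<omega>. snd (snd (snd (snd (snd \<omega>)))) i) \<in> borel_measurable Exp"
proof -
  assume i: "i < N"
  have "(\<lambda>\<omega>. fst (snd (snd (snd (snd \<omega>))))) \<in> Exp \<rightarrow>\<^sub>M Leb N" "(\<lambda>\<omega>. snd (snd (snd (snd (snd \<omega>))))) \<in> Exp \<rightarrow>\<^sub>M Leb N"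
    unfolding exp_space_def by measurable
  from this[THEN measurable_compose[OF _ measurable_component_singleton[of i]]] i
  show "(\<lambda>\<omega>. fst (snd (snd (snd (snd \<omega>)))) i) \<in> borel_measurable Exp"
    "(\<lambda>\<omega>. snd (snd (snd (snd (snd \<omega>)))) i) \<in> borel_measurable Exp" by auto
qed

lemma YZ_meas [measurable]: "chan_Y N f1 f2 \<in> Exp \<rightarrow>\<^sub>M Leb N" "chan_Z N f1 f2 \<in> Exp \<rightarrow>\<^sub>M Leb N"
proof -
  have [measurable]: "(\<lambda>\<omega>. signal f1 f2 (input \<omega>) i) \<in> borel_measurable Exp" for i
    using measurable_compose[OF input_meas signal_meas] .
  show "chan_Y N f1 f2 \<in> Exp \<rightarrow>\<^sub>M Leb N"
    unfolding chan_Y_eq[abs_def] by (intro measurable_restrict) simp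
  show "chan_Z N f1 f2 \<in> Exp \<rightarrow>\<^sub>M Leb N"
    unfolding chan_Z_eq[abs_def] by (intro measurable_restrict) simp
qed

text \<open>For a fixed input the second noise is turned into an integral over \<open>z\<close>
  centred at \<open>y\<close>, then the first into an integral over \<open>y\<close> centred at the
  signal.\<close>

lemma nn_bYZ:
  assumes [measurable]: "F \<in> borel_measurable (Inp \<Otimes>\<^sub>M Leb N \<Otimes>\<^sub>M Leb N)"
  shows "(\<integral>\<^sup>+ \<omega>. F (input \<omega>, chan_Y N f1 f2 \<omega>, chan_Z N f1 f2 \<omega>) \<partial>Exp) =
    (\<integral>\<^sup>+ \<beta>. \<integral>\<^sup>+ y. ennreal (gauss N s1 (signal f1 f2 \<beta>) y) * (\<integral>\<^sup>+ z. ennreal (gauss N s2 y z) * F (\<beta>, y, z) \<partial>Leb N) \<partial>Leb N \<partial>Inp)"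
proof -
  let ?x = "signal f1 f2"
  interpret L: sigma_finite_measure "Leb N" by (rule sigma_finite_Leb)
  have "(\<integral>\<^sup>+ \<omega>. F (input \<omega>, chan_Y N f1 f2 \<omega>, chan_Z N f1 f2 \<omega>) \<partial>Exp) =
    (\<integral>\<^sup>+ w1. \<integral>\<^sup>+ w2. \<integral>\<^sup>+ u1. \<integral>\<^sup>+ u2. \<integral>\<^sup>+ n1. \<integral>\<^sup>+ n2. F ((w1, w2, u1, u2), chan_Y N f1 f2 (w1, w2, u1, u2, n1, n2), chan_Z N f1 f2 (w1, w2, u1, u2, n1, n2))
    \<partial>noise_space N s2 \<partial>noise_space N s1 \<partial>seed_space \<partial>seed_space \<partial>uniform_count_measure {1..M2} \<partial>uniform_count_measure {1..M1})"
    by (subst nn_Exp) simp_all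
  also have "\<dots> = (\<integral>\<^sup>+ w1. \<integral>\<^sup>+ w2. \<integral>\<^sup>+ u1. \<integral>\<^sup>+ u2.
     (\<integral>\<^sup>+ y. ennreal (gauss N s1 (?x (w1, w2, u1, u2)) y) * (\<integral>\<^sup>+ z. ennreal (gauss N s2 y z) * F ((w1, w2, u1, u2), y, z) \<partial>Leb N) \<partial>Leb N)
    \<partial>seed_space \<partial>seed_space \<partial>uniform_count_measure {1..M2} \<partial>uniform_count_measure {1..M1})"
  proof (intro nn_integral_cong)
    fix w1 w2 u1 u2
    assume "w1 \<in> space (uniform_count_measure {1..M1})" "w2 \<in> space (uniform_count_measure {1..M2})"
      "u1 \<in> space seed_space" "u2 \<in> space seed_space"
    then have \<beta> [measurable]: "(w1, w2, u1, u2) \<in> space Inp" by (simp add: input_space_def space_pair_measure)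
    let ?\<beta> = "(w1, w2, u1, u2)"
    have [measurable]: "(\<lambda>(y, z). F (?\<beta>, y, z)) \<in> borel_measurable (Leb N \<Otimes>\<^sub>M Leb N)"
      by measurable
    have G [measurable]: "(\<lambda>y. \<integral>\<^sup>+ z. ennreal (gauss N s2 y z) * F (?\<beta>, y, z) \<partial>Leb N) \<in> borel_measurable (Leb N)"
      by measurable
    have "(\<integral>\<^sup>+ n2. F (?\<beta>, chan_Y N f1 f2 (w1, w2, u1, u2, n1, n2), chan_Z N f1 f2 (w1, w2, u1, u2, n1, n2)) \<partial>noise_space N s2) =
       (\<lambda>y. \<integral>\<^sup>+ z. ennreal (gauss N s2 y z) * F (?\<beta>, y, z) \<partial>Leb N) (\<lambda>i\<in>{..<N}. ?x ?\<beta> i + n1 i)" (is "?l = ?r")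
      if "n1 \<in> space (noise_space N s1)" for n1
    proof -
      let ?y = "\<lambda>i\<in>{..<N}. ?x ?\<beta> i + n1 i"
      have [measurable]: "?y \<in> space (Leb N)" by (simp add: space_PiM)
      \<comment> \<open>Degradedness: once \<open>y\<close> is fixed, \<open>z\<close> is
        \<open>y\<close> plus fresh noise, so \<open>noise_shift\<close> applies with mean
        \<open>y\<close>.\<close>
      have "?l = (\<integral>\<^sup>+ n2. F (?\<beta>, ?y, (\<lambda>i\<in>{..<N}. ?y i + n2 i)) \<partial>noise_space N s2)"
        unfolding chan_Y_eq chan_Z_eq by (simp cong: restrict_cong)
      also have "\<dots> = ?r"
        by (subst noise_shift[OF _ s2_pos, of "\<lambda>z. F (?\<beta>, ?y, z)"]) simp_all
      finally show ?thesis .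
    qed
    then have "(\<integral>\<^sup>+ n1. \<integral>\<^sup>+ n2. F (?\<beta>, chan_Y N f1 f2 (w1, w2, u1, u2, n1, n2), chan_Z N f1 f2 (w1, w2, u1, u2, n1, n2)) \<partial>noise_space N s2 \<partial>noise_space N s1)
      = (\<integral>\<^sup>+ n1. (\<lambda>y. \<integral>\<^sup>+ z. ennreal (gauss N s2 y z) * F (?\<beta>, y, z) \<partial>Leb N) (\<lambda>i\<in>{..<N}. ?x ?\<beta> i + n1 i) \<partial>noise_space N s1)"
      by (intro nn_integral_cong) simp
    also have "\<dots> = (\<integral>\<^sup>+ y. ennreal (gauss N s1 (?x ?\<beta>) y) * (\<integral>\<^sup>+ z. ennreal (gauss N s2 y z) * F (?\<beta>, y, z) \<partial>Leb N) \<partial>Leb N)"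
      by (rule noise_shift[OF G s1_pos])
    finally show "(\<integral>\<^sup>+ n1. \<integral>\<^sup>+ n2. F (?\<beta>, chan_Y N f1 f2 (w1, w2, u1, u2, n1, n2), chan_Z N f1 f2 (w1, w2, u1, u2, n1, n2)) \<partial>noise_space N s2 \<partial>noise_space N s1) = \<dots>" .
  qed
  also have "\<dots> = (\<integral>\<^sup>+ \<beta>. \<integral>\<^sup>+ y. ennreal (gauss N s1 (?x \<beta>) y) * (\<integral>\<^sup>+ z. ennreal (gauss N s2 y z) * F (\<beta>, y, z) \<partial>Leb N) \<partial>Leb N \<partial>Inp)"
    by (rule nn_Inp[symmetric]) measurable
  finally show ?thesis .
qed

text \<open>Places a concrete code in the abstract channel. The substantial obligation is the joint
  density, obtained by evaluating \<open>nn_bYZ\<close> at indicator functions.\<close>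

sublocale gaussian_wiretap Exp Inp N s1 s2 "signal f1 f2" message "{1..M1} \<times> {1..M2}" input "chan_Y N f1 f2" "chan_Z N f1 f2"
proof (intro gaussian_wiretap.intro gaussian_wiretap_axioms.intro)
  show "prob_space Exp" "prob_space Inp" by (rule prob_space_Exp prob_space_Inp)+
  show "message \<beta> \<in> {1..M1} \<times> {1..M2}" if "\<beta> \<in> space Inp" for \<beta>
    using that by (cases \<beta>) (auto simp: input_space_def space_pair_measure space_uniform_count_measure)
  show "distributed Exp (Inp \<Otimes>\<^sub>M Leb N \<Otimes>\<^sub>M Leb N) (\<lambda>\<omega>. (input \<omega>, chan_Y N f1 f2 \<omega>, chan_Z N f1 f2 \<omega>))
     (\<lambda>(\<beta>, y, z). ennreal (gauss N s1 (signal f1 f2 \<beta>) y) * ennreal (gauss N s2 y z))"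
    unfolding distributed_def
  proof (intro conjI)
    let ?d = "\<lambda>(\<beta>, y, z). ennreal (gauss N s1 (signal f1 f2 \<beta>) y) * ennreal (gauss N s2 y z)"
    interpret L: sigma_finite_measure "Leb N" by (rule sigma_finite_Leb)
    interpret LL: pair_sigma_finite "Leb N" "Leb N" ..
    show dm [measurable]: "?d \<in> borel_measurable (Inp \<Otimes>\<^sub>M Leb N \<Otimes>\<^sub>M Leb N)"
    proof -
      have [measurable]: "(\<lambda>p. signal f1 f2 (fst p) i) \<in> borel_measurable (Inp \<Otimes>\<^sub>M Leb N \<Otimes>\<^sub>M Leb N)" for i
        using measurable_compose[OF measurable_fst signal_meas] .
      show ?thesis unfolding split_beta' by measurable
    qed
    show "distr Exp (Inp \<Otimes>\<^sub>M Leb N \<Otimes>\<^sub>M Leb N) (\<lambda>\<omega>. (input \<omega>, chan_Y N f1 f2 \<omega>, chan_Z N f1 f2 \<omega>)) =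
      density (Inp \<Otimes>\<^sub>M Leb N \<Otimes>\<^sub>M Leb N) ?d" (is "?D = ?E")
    proof (rule measure_eqI)
      fix S assume "S \<in> sets ?D"
      then have S [measurable]: "S \<in> sets (Inp \<Otimes>\<^sub>M Leb N \<Otimes>\<^sub>M Leb N)" by simp
      have "emeasure ?D S = (\<integral>\<^sup>+ \<omega>. indicator S (input \<omega>, chan_Y N f1 f2 \<omega>, chan_Z N f1 f2 \<omega>) \<partial>Exp)"
        using nn_integral_distr[of "\<lambda>\<omega>. (input \<omega>, chan_Y N f1 f2 \<omega>, chan_Z N f1 f2 \<omega>)" Exp "Inp \<Otimes>\<^sub>M Leb N \<Otimes>\<^sub>M Leb N" "indicator S"]
        by simp
      also have "\<dots> = (\<integral>\<^sup>+ \<beta>. \<integral>\<^sup>+ y. ennreal (gauss N s1 (signal f1 f2 \<beta>) y) * (\<integral>\<^sup>+ z. ennreal (gauss N s2 y z) * indicator S (\<beta>, y, z) \<partial>Leb N) \<partial>Leb N \<partial>Inp)"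
        by (rule nn_bYZ) simp
      also have "\<dots> = (\<integral>\<^sup>+ \<beta>. \<integral>\<^sup>+ y. \<integral>\<^sup>+ z. ?d (\<beta>, y, z) * indicator S (\<beta>, y, z) \<partial>Leb N \<partial>Leb N \<partial>Inp)"
        by (intro nn_integral_cong) (simp add: nn_integral_cmult[symmetric] mult.assoc)
      also have "\<dots> = (\<integral>\<^sup>+ \<beta>. \<integral>\<^sup>+ p. ?d (\<beta>, p) * indicator S (\<beta>, p) \<partial>(Leb N \<Otimes>\<^sub>M Leb N) \<partial>Inp)"
        by (intro nn_integral_cong L.nn_integral_fst) measurable
      also have "\<dots> = (\<integral>\<^sup>+ p. ?d p * indicator S p \<partial>(Inp \<Otimes>\<^sub>M Leb N \<Otimes>\<^sub>M Leb N))"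
        by (intro LL.P.nn_integral_fst) measurable
      also have "\<dots> = emeasure ?E S" by (simp add: emeasure_density)
      finally show "emeasure ?D S = emeasure ?E S" .
    qed simp
  qed measurable
qed (use s1_pos s2_pos in auto)

end

text \<open>The elementary core of Fano's inequality: \<open>g\<close> is at least \<open>c\<close>
  off the event \<open>E\<close> and at least \<open>c - d\<close> on it. The upper bound serves for
  integrability.\<close>

lemma (in prob_space) expectation_ge_error:
  fixes g :: "'a \<Rightarrow> real"
  assumes [measurable]: "g \<in> borel_measurable M" "E \<in> events"
    and lower: "\<And>\<omega>. \<omega> \<in> space M \<Longrightarrow> c - d * indicator E \<omega> \<le> g \<omega>"
    and upper: "\<And>\<omega>. \<omega> \<in> space M \<Longrightarrow> g \<omega> \<le> u"
  shows "integrable M g" "c - d * prob E \<le> expectation g"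
proof -
  show int: "integrable M g"
  proof (rule integrable_const_bound[where B="\<bar>c\<bar> + \<bar>d\<bar> + \<bar>u\<bar>"])
    have "norm (g \<omega>) \<le> \<bar>c\<bar> + \<bar>d\<bar> + \<bar>u\<bar>" if "\<omega> \<in> space M" for \<omega>
      using lower[OF that] upper[OF that] by (cases "\<omega> \<in> E") auto
    then show "AE \<omega> in M. norm (g \<omega>) \<le> \<bar>c\<bar> + \<bar>d\<bar> + \<bar>u\<bar>" by (intro AE_I2)
  qed simp
  have "c - d * prob E = expectation (\<lambda>\<omega>. c - d * indicator E \<omega>)"
    by (simp add: prob_space emeasure_eq_measure)
  also have "\<dots> \<le> expectation g"
    using int lower by (intro integral_mono) (auto simp: emeasure_eq_measure)
  finally show "c - d * prob E \<le> expectation g" .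
qed

context wiretap_code
begin

section \<open>Bounds for a code in terms of its error probability and input powers\<close>

abbreviation "x1 \<equiv> signal1 f1"
abbreviation "x2 \<equiv> signal2 f2"
abbreviation "P_err \<equiv> err_prob N M1 M2 s1 s2 f1 f2 \<psi>"

definition error_event where
  "error_event = {\<omega> \<in> space Exp. \<psi> (chan_Y N f1 f2 \<omega>) \<noteq> message (input \<omega>)}"

lemma msgs_eq: "msgs = (\<lambda>\<omega>. message (input \<omega>))"
  by (rule ext) (auto simp: msgs_def)

lemma P_err_eq: "P_err = prob error_event"
  by (simp add: err_prob_def error_event_def msgs_eq)

lemma error_event_meas [measurable]: "error_event \<in> events"
proof -
  have [measurable]: "(\<lambda>\<omega>. \<psi> (chan_Y N f1 f2 \<omega>)) \<in> Exp \<rightarrow>\<^sub>M count_space UNIV"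
    "(\<lambda>\<omega>. message (input \<omega>)) \<in> Exp \<rightarrow>\<^sub>M count_space UNIV" by measurable
  have "Measurable.pred Exp (\<lambda>\<omega>. \<psi> (chan_Y N f1 f2 \<omega>) \<noteq> message (input \<omega>))"
    by (rule measurable_compose_countable'[where f="\<lambda>w \<omega>. \<psi> (chan_Y N f1 f2 \<omega>) \<noteq> w" and g="\<lambda>\<omega>. message (input \<omega>)" and I=UNIV])
       simp_all
  then show ?thesis unfolding error_event_def by (rule predE)
qed

text \<open>The Fano term arises from \<open>- E (ln \<kappa>)\<close>: the cost is at most
  \<open>ln 2\<close> when decoding succeeds and at most \<open>ln (M1 * M2)\<close> more when it
  fails.\<close>

lemma conditional_entropy_code_le:
  assumes e: "\<And>i. i < N \<Longrightarrow> (\<integral>\<^sup>+ \<beta>. ennreal ((signal f1 f2 \<beta> i)\<^sup>2) \<partial>Inp) = ennreal (e i)" "\<And>i. i < N \<Longrightarrow> 0 \<le> e i"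
    and Q: "(\<Sum>i<N. e i) \<le> real N * Q" "0 \<le> Q"
  shows "conditional_entropy 2 (count_space UNIV) (Leb N) msgs (chan_Z N f1 f2) * ln 2 \<le>
    real N / 2 * ln ((Q + s1) * (s1 + s2) / (s1 * (Q + s1 + s2))) + ln 2 + P_err * ln (real M1 * real M2)"
proof -
  let ?M = "real M1 * real M2"
  have M: "?M \<ge> 1" using M_ge1 by (metis mult_mono of_nat_1 of_nat_le_iff mult_1 of_nat_0_le_iff zero_le_one)
  \<comment> \<open>Half of the mass sits on the decoder output and half is spread uniformly over
    the message pairs, which keeps \<open>\<kappa>\<close> positive even after a decoding
    error.\<close>
  define \<kappa> where "\<kappa> w y = (if \<psi> y = w then 1 / 2 else 0) + 1 / (2 * ?M)" for w y
  have \<kappa>_meas [measurable]: "case_prod \<kappa> \<in> borel_measurable (count_space UNIV \<Otimes>\<^sub>M Leb N)"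
    unfolding split_beta'
    by (rule measurable_compose_countable'[where f="\<lambda>w p. \<kappa> w (snd p)" and g=fst and I=UNIV])
       (auto simp: \<kappa>_def)
  have \<kappa>_pos: "0 < \<kappa> w y" for w y using M by (auto simp: \<kappa>_def intro!: add_nonneg_pos)
  have sum: "(\<Sum>w\<in>{1..M1} \<times> {1..M2}. \<kappa> w y) \<le> 1" for y
  proof -
    \<comment> \<open>The decoder may output something that is no message pair; its half of the mass
      is then lost and the sum is only \<open>1/2\<close>.\<close>
    have "(\<Sum>w\<in>{1..M1} \<times> {1..M2}. \<kappa> w y) = (if \<psi> y \<in> {1..M1} \<times> {1..M2} then 1 / 2 else 0) + ?M * (1 / (2 * ?M))"
      unfolding \<kappa>_def sum.distrib by (simp add: sum.delta')
    also have "?M * (1 / (2 * ?M)) = 1 / 2" using M_ge1 by simp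
    finally show ?thesis by simp
  qed
  have ln\<kappa>: "- ln 2 - ln ?M * indicator error_event \<omega> \<le> ln (\<kappa> (message (input \<omega>)) (chan_Y N f1 f2 \<omega>))"
    if "\<omega> \<in> space Exp" for \<omega>
  proof (cases "\<omega> \<in> error_event")
    case True
    have "- ln 2 - ln ?M = ln (1 / (2 * ?M))" using M_ge1 by (simp add: ln_div ln_mult)
    also have "\<dots> \<le> ln (\<kappa> (message (input \<omega>)) (chan_Y N f1 f2 \<omega>))"
      using M \<kappa>_pos by (subst ln_le_cancel_iff) (auto simp: \<kappa>_def)
    finally show ?thesis using True by simp
  next
    case False
    have "- ln 2 = ln (1 / 2 :: real)" by (simp add: ln_div)
    moreover have "1 / 2 \<le> \<kappa> (message (input \<omega>)) (chan_Y N f1 f2 \<omega>)"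
      using False that by (auto simp: \<kappa>_def error_event_def)
    ultimately have "- ln 2 \<le> ln (\<kappa> (message (input \<omega>)) (chan_Y N f1 f2 \<omega>))"
      using \<kappa>_pos by simp
    then show ?thesis using False by simp
  qed
  have \<kappa>1: "\<kappa> w y \<le> 1" for w y
  proof -
    have "1 / (2 * ?M) \<le> 1 / 2" using M by (simp add: field_simps)
    then show ?thesis by (auto simp: \<kappa>_def)
  qed
  have [measurable]: "(\<lambda>\<omega>. message (input \<omega>)) \<in> Exp \<rightarrow>\<^sub>M count_space UNIV" by measurable
  have [measurable]: "(\<lambda>\<omega>. \<kappa> (message (input \<omega>)) (chan_Y N f1 f2 \<omega>)) \<in> borel_measurable Exp"
    by measurable
  note E = expectation_ge_error[of "\<lambda>\<omega>. ln (\<kappa> (message (input \<omega>)) (chan_Y N f1 f2 \<omega>))" error_event "- ln 2" "ln ?M" 0]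
  have "conditional_entropy 2 (count_space UNIV) (Leb N) (\<lambda>\<omega>. message (input \<omega>)) (chan_Z N f1 f2) * ln 2 \<le>
    real N / 2 * ln ((Q + s1) * (s1 + s2) / (s1 * (Q + s1 + s2))) - expectation (\<lambda>\<omega>. ln (\<kappa> (message (input \<omega>)) (chan_Y N f1 f2 \<omega>)))"
  proof (rule conditional_entropy_le)
    show "integrable Exp (\<lambda>\<omega>. ln (\<kappa> (message (input \<omega>)) (chan_Y N f1 f2 \<omega>)))"
      using ln\<kappa> \<kappa>1 \<kappa>_pos by (intro E(1)) (auto simp: ln_le_zero_iff)
  qed (use \<kappa>_meas less_imp_le[OF \<kappa>_pos] \<kappa>_pos sum e Q in auto)
  moreover have "- ln 2 - ln ?M * prob error_event \<le> expectation (\<lambda>\<omega>. ln (\<kappa> (message (input \<omega>)) (chan_Y N f1 f2 \<omega>)))"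
    using ln\<kappa> \<kappa>1 \<kappa>_pos by (intro E(2)) (auto simp: ln_le_zero_iff)
  ultimately show ?thesis by (simp add: msgs_eq P_err_eq mult.commute)
qed

text \<open>The prediction is \<open>V = (1 + \<alpha>) * x1\<close>, which differs from the signal
  by exactly \<open>x2 - \<alpha> * x1\<close>. It involves the first message and its seed only,
  which keeps it independent of the second message.\<close>

lemma rate2_le:
  fixes \<alpha> \<tau> :: real
  assumes e: "\<And>i. i < N \<Longrightarrow> (\<integral>\<^sup>+ \<beta>. ennreal ((x2 \<beta> i - \<alpha> * x1 \<beta> i)\<^sup>2) \<partial>Inp) = ennreal (e i)" "\<And>i. i < N \<Longrightarrow> 0 \<le> e i"
    and \<tau>: "(\<Sum>i<N. e i) + real N * s1 \<le> real N * \<tau>" "0 < \<tau>"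
  shows "ln (real M2) - ln 2 - P_err * ln (real M2) \<le> real N / 2 * ln (\<tau> / s1)"
proof -
  \<comment> \<open>\<open>M2\<close> times a test distribution, that is, a likelihood ratio against
    the uniform law of the second message. It is at least \<open>M2 / 2\<close> after correct
    decoding and at least \<open>1 / 2\<close> always.\<close>
  define \<kappa> where "\<kappa> w y = (if snd (\<psi> y) = w then real M2 / 2 else 0) + 1 / 2" for w :: nat and y
  have M: "real M2 \<ge> 1" using M_ge1 by simp
  have \<kappa>_meas' [measurable]: "case_prod \<kappa> \<in> borel_measurable (count_space UNIV \<Otimes>\<^sub>M Leb N)"
    unfolding split_beta'
    by (rule measurable_compose_countable'[where f="\<lambda>w p. \<kappa> w (snd p)" and g=fst and I=UNIV])
       (auto simp: \<kappa>_def)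
  have \<kappa>_pos: "0 < \<kappa> w y" for w y by (auto simp: \<kappa>_def intro!: add_nonneg_pos)
  have [measurable]: "(\<lambda>\<beta>. snd (message \<beta>)) \<in> Inp \<rightarrow>\<^sub>M count_space UNIV"
    using measurable_compose[OF message_meas, of snd] by simp
  have [measurable]: "(\<lambda>\<omega>. snd (message (input \<omega>))) \<in> Exp \<rightarrow>\<^sub>M count_space UNIV"
    using measurable_compose[OF measurable_compose[OF input_meas message_meas], of snd] by simp
  have \<kappa>_meas [measurable]: "case_prod (\<lambda>\<beta>. \<kappa> (snd (message \<beta>))) \<in> borel_measurable (Inp \<Otimes>\<^sub>M Leb N)"
    by measurable
  have ln\<kappa>: "(ln (real M2) - ln 2) - ln (real M2) * indicator error_event \<omega> \<le> ln (\<kappa> (snd (message (input \<omega>))) (chan_Y N f1 f2 \<omega>))"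
    if "\<omega> \<in> space Exp" for \<omega>
  proof (cases "\<omega> \<in> error_event")
    case True
    have "- ln 2 = ln (1 / 2 :: real)" by (simp add: ln_div)
    also have "\<dots> \<le> ln (\<kappa> (snd (message (input \<omega>))) (chan_Y N f1 f2 \<omega>))"
      using M \<kappa>_pos by (subst ln_le_cancel_iff) (auto simp: \<kappa>_def)
    finally show ?thesis using True by simp
  next
    case False
    have "ln (real M2) - ln 2 = ln (real M2 / 2)" using M by (simp add: ln_div)
    also have "\<dots> \<le> ln (\<kappa> (snd (message (input \<omega>))) (chan_Y N f1 f2 \<omega>))"
      using False that M \<kappa>_pos by (subst ln_le_cancel_iff) (auto simp: \<kappa>_def error_event_def)
    finally show ?thesis using False by simp
  qed
  have \<kappa>_le: "\<kappa> w y \<le> real M2" for w y using M by (auto simp: \<kappa>_def)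
  have [measurable]: "(\<lambda>\<omega>. \<kappa> (snd (message (input \<omega>))) (chan_Y N f1 f2 \<omega>)) \<in> borel_measurable Exp"
    by measurable
  note E = expectation_ge_error[of "\<lambda>\<omega>. ln (\<kappa> (snd (message (input \<omega>))) (chan_Y N f1 f2 \<omega>))" error_event "ln (real M2) - ln 2" "ln (real M2)" "ln (real M2)"]
  have "expectation (\<lambda>\<omega>. ln (\<kappa> (snd (message (input \<omega>))) (chan_Y N f1 f2 \<omega>))) \<le> real N / 2 * ln (\<tau> / s1)"
  proof (rule expectation_ln_le[where \<kappa>="\<lambda>\<beta>. \<kappa> (snd (message \<beta>))" and V="\<lambda>\<beta> i. (1 + \<alpha>) * x1 \<beta> i"])
    show "integrable Exp (\<lambda>\<omega>. ln (\<kappa> (snd (message (input \<omega>))) (chan_Y N f1 f2 \<omega>)))"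
      using ln\<kappa> \<kappa>_le \<kappa>_pos M by (intro E(1)) auto
    show "(\<integral>\<^sup>+ \<beta>. ennreal ((signal f1 f2 \<beta> i - (1 + \<alpha>) * x1 \<beta> i)\<^sup>2) \<partial>Inp) = ennreal (e i)" if "i < N" for i
      using e(1)[OF that] by (simp add: signal_def algebra_simps)
    let ?V = "\<lambda>w u i. (1 + \<alpha>) * f1 w u i"
    let ?U1 = "uniform_count_measure {1..M1}" and ?U2 = "uniform_count_measure {1..M2}"
    interpret L: sigma_finite_measure "Leb N" by (rule sigma_finite_Leb)
    have V_meas [measurable]: "(\<lambda>p. (1 + \<alpha>) * x1 (fst p) i) \<in> borel_measurable (Inp \<Otimes>\<^sub>M Leb N)" for i
      using measurable_compose[OF measurable_fst signal1_meas[of i]] by measurable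
    have avg: "(\<Sum>w2\<in>{1..M2}. ennreal (\<kappa> w2 y)) \<le> ennreal (real M2)" for y
    proof -
      have "(\<Sum>w2\<in>{1..M2}. \<kappa> w2 y) = (if snd (\<psi> y) \<in> {1..M2} then real M2 / 2 else 0) + real M2 / 2"
        unfolding \<kappa>_def sum.distrib by (simp add: sum.delta')
      also have "\<dots> \<le> real M2" by simp
      finally show ?thesis using \<kappa>_pos by (simp add: sum_ennreal less_imp_le ennreal_leI)
    qed
    have "(\<integral>\<^sup>+ \<beta>. \<integral>\<^sup>+ y. ennreal (\<kappa> (snd (message \<beta>)) y * gauss N \<tau> (\<lambda>i. (1 + \<alpha>) * x1 \<beta> i) y) \<partial>Leb N \<partial>Inp)
       = (\<integral>\<^sup>+ w1. \<integral>\<^sup>+ w2. \<integral>\<^sup>+ u1. \<integral>\<^sup>+ u2. \<integral>\<^sup>+ y. ennreal (\<kappa> w2 y * gauss N \<tau> (?V w1 u1) y) \<partial>Leb N \<partial>seed_space \<partial>seed_space \<partial>?U2 \<partial>?U1)"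
      by (subst nn_Inp) simp_all
    also have "\<dots> = (\<integral>\<^sup>+ w1. \<integral>\<^sup>+ w2. \<integral>\<^sup>+ u1. \<integral>\<^sup>+ y. ennreal (\<kappa> w2 y * gauss N \<tau> (?V w1 u1) y) \<partial>Leb N \<partial>seed_space \<partial>?U2 \<partial>?U1)"
      by (simp add: SE.emeasure_space_1)
    \<comment> \<open>The reference Gaussian depends on \<open>w1\<close> and \<open>u1\<close>
      only. The average over \<open>w2\<close> therefore acts on \<open>\<kappa>\<close> alone,
      whose sum over \<open>w2\<close> is at most \<open>M2\<close>.\<close>
    also have "\<dots> = (\<integral>\<^sup>+ w1. ennreal (1 / real M2) * (\<integral>\<^sup>+ u1. \<integral>\<^sup>+ y. (\<Sum>w2\<in>{1..M2}. ennreal (\<kappa> w2 y * gauss N \<tau> (?V w1 u1) y)) \<partial>Leb N \<partial>seed_space) \<partial>?U1)"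
      unfolding nn_integral_uniform_count[OF M_ge1(2)] by (simp add: nn_integral_sum)
    also have "\<dots> \<le> (\<integral>\<^sup>+ w1. ennreal (1 / real M2) * (\<integral>\<^sup>+ u1. \<integral>\<^sup>+ y. ennreal (real M2) * ennreal (gauss N \<tau> (?V w1 u1) y) \<partial>Leb N \<partial>seed_space) \<partial>?U1)"
    proof (intro nn_integral_mono mult_left_mono)
      fix w1 u1 y
      have "(\<Sum>w2\<in>{1..M2}. ennreal (\<kappa> w2 y * gauss N \<tau> (?V w1 u1) y)) = (\<Sum>w2\<in>{1..M2}. ennreal (\<kappa> w2 y)) * ennreal (gauss N \<tau> (?V w1 u1) y)"
        unfolding sum_distrib_right using \<kappa>_pos
        by (intro sum.cong refl) (simp add: ennreal_mult less_imp_le)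
      also have "\<dots> \<le> ennreal (real M2) * ennreal (gauss N \<tau> (?V w1 u1) y)"
        by (intro mult_right_mono avg) simp
      finally show "(\<Sum>w2\<in>{1..M2}. ennreal (\<kappa> w2 y * gauss N \<tau> (?V w1 u1) y)) \<le> \<dots>" .
    qed simp
    also have "\<dots> = (\<integral>\<^sup>+ w1. ennreal (1 / real M2) * ennreal (real M2) \<partial>?U1)"
      using \<tau> by (simp add: nn_integral_cmult nn_integral_gauss SE.emeasure_space_1)
    also have "\<dots> = 1" using M by (simp add: C1.emeasure_space_1 ennreal_mult[symmetric] del: One_nat_def)
    finally show "(\<integral>\<^sup>+ \<beta>. \<integral>\<^sup>+ y. ennreal (\<kappa> (snd (message \<beta>)) y * gauss N \<tau> (\<lambda>i. (1 + \<alpha>) * x1 \<beta> i) y) \<partial>Leb N \<partial>Inp) \<le> 1" .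
  qed (use \<kappa>_meas \<kappa>_pos e \<tau> in simp_all)
  moreover have "(ln (real M2) - ln 2) - ln (real M2) * prob error_event \<le> expectation (\<lambda>\<omega>. ln (\<kappa> (snd (message (input \<omega>))) (chan_Y N f1 f2 \<omega>)))"
    using ln\<kappa> \<kappa>_le \<kappa>_pos M by (intro E(2)) auto
  ultimately show ?thesis by (simp add: P_err_eq mult.commute)
qed

section \<open>Powers and correlation of the two signals\<close>

lemma nn_input:
  assumes [measurable]: "F \<in> borel_measurable Inp"
  shows "(\<integral>\<^sup>+ \<omega>. F (input \<omega>) \<partial>Exp) = (\<integral>\<^sup>+ \<beta>. F \<beta> \<partial>Inp)"
  by (simp add: nn_Exp nn_Inp N1.emeasure_space_1 N2.emeasure_space_1)

lemma power_sum:
  "(\<Sum>i<N. \<integral>\<^sup>+ \<beta>. ennreal ((x1 \<beta> i)\<^sup>2) \<partial>Inp) \<le> ennreal (real N * P1)"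
  "(\<Sum>i<N. \<integral>\<^sup>+ \<beta>. ennreal ((x2 \<beta> i)\<^sup>2) \<partial>Inp) \<le> ennreal (real N * P2)"
proof -
  have c: "chan_X1 f1 \<omega> i = x1 (input \<omega>) i" "chan_X2 f2 \<omega> i = x2 (input \<omega>) i" for \<omega> i
    by (cases \<omega> rule: input.cases, simp add: chan_X1_def chan_X2_def)+
  have n: "(\<integral>\<^sup>+ \<beta>. ennreal ((x1 \<beta> i)\<^sup>2) \<partial>Inp) = (\<integral>\<^sup>+ \<omega>. ennreal ((chan_X1 f1 \<omega> i)\<^sup>2) \<partial>Exp)"
    "(\<integral>\<^sup>+ \<beta>. ennreal ((x2 \<beta> i)\<^sup>2) \<partial>Inp) = (\<integral>\<^sup>+ \<omega>. ennreal ((chan_X2 f2 \<omega> i)\<^sup>2) \<partial>Exp)" for i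
    unfolding c by (rule nn_input[symmetric], measurable)+
  show "(\<Sum>i<N. \<integral>\<^sup>+ \<beta>. ennreal ((x1 \<beta> i)\<^sup>2) \<partial>Inp) \<le> ennreal (real N * P1)"
    "(\<Sum>i<N. \<integral>\<^sup>+ \<beta>. ennreal ((x2 \<beta> i)\<^sup>2) \<partial>Inp) \<le> ennreal (real N * P2)"
    unfolding n using valid by (auto simp: valid_code_def)
qed

text \<open>Each squared signal is one summand of a total that the power constraint makes finite;
  the product is dominated by the sum of the two squares.\<close>

lemma integrable_squares:
  assumes "i < N"
  shows "integrable Inp (\<lambda>\<beta>. (x1 \<beta> i)\<^sup>2)" "integrable Inp (\<lambda>\<beta>. (x2 \<beta> i)\<^sup>2)" "integrable Inp (\<lambda>\<beta>. x1 \<beta> i * x2 \<beta> i)"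
proof -
  have "(\<integral>\<^sup>+ \<beta>. ennreal ((x1 \<beta> i)\<^sup>2) \<partial>Inp) \<le> (\<Sum>i<N. \<integral>\<^sup>+ \<beta>. ennreal ((x1 \<beta> i)\<^sup>2) \<partial>Inp)"
    "(\<integral>\<^sup>+ \<beta>. ennreal ((x2 \<beta> i)\<^sup>2) \<partial>Inp) \<le> (\<Sum>i<N. \<integral>\<^sup>+ \<beta>. ennreal ((x2 \<beta> i)\<^sup>2) \<partial>Inp)"
    using assms by (intro member_le_sum; simp)+
  from order_trans[OF this(1) power_sum(1)] order_trans[OF this(2) power_sum(2)]
  have "(\<integral>\<^sup>+ \<beta>. ennreal ((x1 \<beta> i)\<^sup>2) \<partial>Inp) < \<infinity>" "(\<integral>\<^sup>+ \<beta>. ennreal ((x2 \<beta> i)\<^sup>2) \<partial>Inp) < \<infinity>"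
    by (auto elim: order_le_less_trans)
  then show 1: "integrable Inp (\<lambda>\<beta>. (x1 \<beta> i)\<^sup>2)" and 2: "integrable Inp (\<lambda>\<beta>. (x2 \<beta> i)\<^sup>2)"
    by (intro integrableI_nonneg; simp)+
  show "integrable Inp (\<lambda>\<beta>. x1 \<beta> i * x2 \<beta> i)"
  proof (rule Bochner_Integration.integrable_bound[OF Bochner_Integration.integrable_add[OF 1 2]])
    have "\<bar>u * v\<bar> \<le> u\<^sup>2 + v\<^sup>2" for u v :: real
      using sum_squares_bound[of "\<bar>u\<bar>" "\<bar>v\<bar>"] mult_nonneg_nonneg[of "\<bar>u\<bar>" "\<bar>v\<bar>"]
      unfolding abs_mult power2_abs by linarith
    then show "AE \<beta> in Inp. norm (x1 \<beta> i * x2 \<beta> i) \<le> norm ((x1 \<beta> i)\<^sup>2 + (x2 \<beta> i)\<^sup>2)"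
      by (intro AE_I2) simp
  qed measurable
qed

definition m11 where "m11 i = (\<integral>\<beta>. (x1 \<beta> i)\<^sup>2 \<partial>Inp)"
definition m22 where "m22 i = (\<integral>\<beta>. (x2 \<beta> i)\<^sup>2 \<partial>Inp)"
definition m12 where "m12 i = (\<integral>\<beta>. x1 \<beta> i * x2 \<beta> i \<partial>Inp)"
text \<open>The number \<open>c\<close> of the overview: a block average of uncentred correlations,
  as power constraints bound second moments and not variances.\<close>

definition cor where "cor = (\<Sum>i<N. m12 i) / real N"

lemma sum_m: "(\<Sum>i<N. m11 i) \<le> real N * P1" "(\<Sum>i<N. m22 i) \<le> real N * P2" "(\<Sum>i<N. m12 i) = real N * cor"
proof -
  have 1: "(\<integral>\<^sup>+ \<beta>. ennreal ((x1 \<beta> i)\<^sup>2) \<partial>Inp) = ennreal (m11 i)"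
     "(\<integral>\<^sup>+ \<beta>. ennreal ((x2 \<beta> i)\<^sup>2) \<partial>Inp) = ennreal (m22 i)" if "i \<in> {..<N}" for i
    using integrable_squares[of i] that unfolding m11_def m22_def by (simp_all add: nn_integral_eq_integral)
  have nn: "m11 i \<ge> 0" "m22 i \<ge> 0" for i by (simp_all add: m11_def m22_def)
  have "0 \<le> real N * P1" "0 \<le> real N * P2" using P1_pos P2_pos by simp_all
  then show "(\<Sum>i<N. m11 i) \<le> real N * P1" "(\<Sum>i<N. m22 i) \<le> real N * P2"
    using power_sum by (simp_all add: 1 nn sum_ennreal)
  show "(\<Sum>i<N. m12 i) = real N * cor" using N_pos by (simp add: cor_def)
qed

text \<open>One parameter serves both rate bounds: \<open>\<alpha> = 1\<close> gives the total
  signal, and \<open>\<alpha> = - (cor / P1)\<close> the residual of the second signal after linear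
  prediction from the first.\<close>

lemma nn_combination:
  assumes "i < N"
  shows "(\<integral>\<^sup>+ \<beta>. ennreal ((x2 \<beta> i + \<alpha> * x1 \<beta> i)\<^sup>2) \<partial>Inp) = ennreal (m22 i + 2 * \<alpha> * m12 i + \<alpha>\<^sup>2 * m11 i)"
    and "0 \<le> m22 i + 2 * \<alpha> * m12 i + \<alpha>\<^sup>2 * m11 i"
proof -
  note int = integrable_squares[OF assms]
  have eq: "(x2 \<beta> i + \<alpha> * x1 \<beta> i)\<^sup>2 = (x2 \<beta> i)\<^sup>2 + 2 * \<alpha> * (x1 \<beta> i * x2 \<beta> i) + \<alpha>\<^sup>2 * (x1 \<beta> i)\<^sup>2" for \<beta>
    by (simp add: power2_eq_square algebra_simps)
  have i: "integrable Inp (\<lambda>\<beta>. (x2 \<beta> i + \<alpha> * x1 \<beta> i)\<^sup>2)" unfolding eq using int by simp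
  have v: "(\<integral>\<beta>. (x2 \<beta> i + \<alpha> * x1 \<beta> i)\<^sup>2 \<partial>Inp) = m22 i + 2 * \<alpha> * m12 i + \<alpha>\<^sup>2 * m11 i"
    unfolding eq m11_def m12_def m22_def using int by simp
  show "(\<integral>\<^sup>+ \<beta>. ennreal ((x2 \<beta> i + \<alpha> * x1 \<beta> i)\<^sup>2) \<partial>Inp) = ennreal (m22 i + 2 * \<alpha> * m12 i + \<alpha>\<^sup>2 * m11 i)"
    using nn_integral_eq_integral[OF i] by (simp add: v)
  have "0 \<le> (\<integral>\<beta>. (x2 \<beta> i + \<alpha> * x1 \<beta> i)\<^sup>2 \<partial>Inp)" by simp
  then show "0 \<le> m22 i + 2 * \<alpha> * m12 i + \<alpha>\<^sup>2 * m11 i" unfolding v .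
qed

text \<open>The power constraints enter with the nonnegative weights 1 and
  \<open>\<alpha>\<^sup>2\<close>, while the cross term is an equality; hence
  \<open>\<alpha>\<close> may have either sign.\<close>

lemma sum_combination:
  "(\<Sum>i<N. m22 i + 2 * \<alpha> * m12 i + \<alpha>\<^sup>2 * m11 i) \<le> real N * (P2 + 2 * \<alpha> * cor + \<alpha>\<^sup>2 * P1)"
proof -
  have "(\<Sum>i<N. m22 i + 2 * \<alpha> * m12 i + \<alpha>\<^sup>2 * m11 i) = (\<Sum>i<N. m22 i) + 2 * \<alpha> * (\<Sum>i<N. m12 i) + \<alpha>\<^sup>2 * (\<Sum>i<N. m11 i)"
    by (simp add: sum.distrib sum_distrib_left)
  also have "\<dots> \<le> real N * P2 + 2 * \<alpha> * (real N * cor) + \<alpha>\<^sup>2 * (real N * P1)"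
    unfolding sum_m(3) using sum_m by (intro add_mono mult_left_mono order_refl) auto
  finally show ?thesis by (simp add: algebra_simps)
qed

text \<open>The right-hand side dominates a sum of expected squares. At
  \<open>\<alpha> = - (cor / P1)\<close> this is the Cauchy-Schwarz bound
  \<open>cor\<^sup>2 \<le> P1 * P2\<close>.\<close>

lemma combination_nonneg: "0 \<le> P2 + 2 * \<alpha> * cor + \<alpha>\<^sup>2 * P1"
proof -
  have "0 \<le> real N * (P2 + 2 * \<alpha> * cor + \<alpha>\<^sup>2 * P1)"
    by (rule order_trans[OF sum_nonneg sum_combination]) (use nn_combination(2) in auto)
  then show ?thesis using N_pos by (simp add: zero_le_mult_iff)
qed

text \<open>This \<open>\<alpha>\<close> minimises the quadratic, so the reference Gaussian built
  from it yields the smallest bound.\<close>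

lemma residual_power: "P2 + 2 * (- (cor / P1)) * cor + (- (cor / P1))\<^sup>2 * P1 = P2 - cor\<^sup>2 / P1"
  using P1_pos by (simp add: power2_eq_square field_simps)

lemma code_bounds:
  "conditional_entropy 2 (count_space UNIV) (Leb N) msgs (chan_Z N f1 f2) * ln 2 \<le>
    real N / 2 * ln ((P1 + P2 + 2 * cor + s1) * (s1 + s2) / (s1 * (P1 + P2 + 2 * cor + s1 + s2))) + ln 2 + P_err * ln (real M1 * real M2)"
  "ln (real M2) - ln 2 - P_err * ln (real M2) \<le> real N / 2 * ln ((s1 + (P2 - cor\<^sup>2 / P1)) / s1)"
  "0 \<le> P1 + P2 + 2 * cor" "0 \<le> P2 - cor\<^sup>2 / P1"
proof -
  show Q: "0 \<le> P1 + P2 + 2 * cor" using combination_nonneg[of 1] by simp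
  show R: "0 \<le> P2 - cor\<^sup>2 / P1" using combination_nonneg[of "- (cor / P1)"] unfolding residual_power .
  show "conditional_entropy 2 (count_space UNIV) (Leb N) msgs (chan_Z N f1 f2) * ln 2 \<le>
    real N / 2 * ln ((P1 + P2 + 2 * cor + s1) * (s1 + s2) / (s1 * (P1 + P2 + 2 * cor + s1 + s2))) + ln 2 + P_err * ln (real M1 * real M2)"
  proof (rule conditional_entropy_code_le[OF _ _ _ Q])
    fix i assume "i < N"
    from nn_combination[OF this, of 1]
    show "(\<integral>\<^sup>+ \<beta>. ennreal ((signal f1 f2 \<beta> i)\<^sup>2) \<partial>Inp) = ennreal (m22 i + 2 * m12 i + m11 i)"
      "0 \<le> m22 i + 2 * m12 i + m11 i"
      by (simp_all add: signal_def add.commute)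
  next
    show "(\<Sum>i<N. m22 i + 2 * m12 i + m11 i) \<le> real N * (P1 + P2 + 2 * cor)"
      using sum_combination[of 1] by (simp add: add.assoc add.commute[of P1])
  qed
  show "ln (real M2) - ln 2 - P_err * ln (real M2) \<le> real N / 2 * ln ((s1 + (P2 - cor\<^sup>2 / P1)) / s1)"
  proof (rule rate2_le)
    fix i assume "i < N"
    from nn_combination[OF this, of "- (cor / P1)"]
    show "(\<integral>\<^sup>+ \<beta>. ennreal ((x2 \<beta> i - cor / P1 * x1 \<beta> i)\<^sup>2) \<partial>Inp) = ennreal (m22 i + 2 * (- (cor / P1)) * m12 i + (- (cor / P1))\<^sup>2 * m11 i)"
      "0 \<le> m22 i + 2 * (- (cor / P1)) * m12 i + (- (cor / P1))\<^sup>2 * m11 i"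
      by simp_all
  next
    show "(\<Sum>i<N. m22 i + 2 * (- (cor / P1)) * m12 i + (- (cor / P1))\<^sup>2 * m11 i) + real N * s1 \<le> real N * (s1 + (P2 - cor\<^sup>2 / P1))"
      using sum_combination[of "- (cor / P1)"] unfolding residual_power by (simp add: distrib_left)
    show "0 < s1 + (P2 - cor\<^sup>2 / P1)" using R s1_pos by simp
  qed
qed

end

section \<open>The outer bound\<close>

definition sum_rate_bound :: "real \<Rightarrow> real \<Rightarrow> real \<Rightarrow> real \<Rightarrow> real \<Rightarrow> real" where
  "sum_rate_bound P1 P2 s1 s2 \<rho> = 1/2 * log 2 (1 + (P1 + P2 + 2 * sqrt (P1 * P2) * \<rho>) / s1)
               - 1/2 * log 2 (1 + (P1 + P2 + 2 * sqrt (P1 * P2) * \<rho>) / (s1 + s2))"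

definition rate2_bound :: "real \<Rightarrow> real \<Rightarrow> real \<Rightarrow> real" where
  "rate2_bound P2 s1 \<rho> = 1/2 * log 2 (1 + (1 - \<rho>\<^sup>2) * P2 / s1)"

text \<open>A single \<open>\<rho>\<close>, determined by the code, satisfies both bounds at once;
  the outer region needs a common value.\<close>

lemma (in wiretap_code) code_rate_bounds:
  obtains \<rho> where "\<rho> \<in> {-1..1}"
    "equivocation N M1 M2 s1 s2 f1 f2 \<le> sum_rate_bound P1 P2 s1 s2 \<rho> + (1 + P_err * (log 2 (real M1) + log 2 (real M2))) / real N"
    "log 2 (real M2) / real N \<le> rate2_bound P2 s1 \<rho> + (1 + P_err * log 2 (real M2)) / real N"
proof
  \<comment> \<open>The normalised correlation. That it lies in \<open>{-1..1}\<close> follows from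
    the nonnegativity of the residual power \<open>P2 - cor\<^sup>2 / P1\<close>.\<close>
  define \<rho> where "\<rho> = cor / sqrt (P1 * P2)"
  have sq: "sqrt (P1 * P2) > 0" using P1_pos P2_pos by simp
  have cor: "cor = sqrt (P1 * P2) * \<rho>" using P1_pos P2_pos by (simp add: \<rho>_def)
  have cor2: "cor\<^sup>2 / P1 = \<rho>\<^sup>2 * P2" using P1_pos P2_pos by (simp add: cor power_mult_distrib)
  have "\<rho>\<^sup>2 * P2 \<le> 1 * P2" using code_bounds(4) unfolding cor2 by simp
  then have "\<rho>\<^sup>2 \<le> 1" using P2_pos by (rule mult_right_le_imp_le)
  then show "\<rho> \<in> {-1..1}" using abs_square_le_1[of \<rho>] by auto
  define Q where "Q = P1 + P2 + 2 * cor"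
  have Q: "Q \<ge> 0" using code_bounds(3) by (simp add: Q_def)
  have Q_eq: "P1 + P2 + 2 * sqrt (P1 * P2) * \<rho> = Q" by (simp add: Q_def cor)
  have ln2: "ln 2 > (0::real)" by simp
  have "(Q + s1) * (s1 + s2) / (s1 * (Q + s1 + s2)) = (1 + Q / s1) / (1 + Q / (s1 + s2))"
  proof -
    have "1 + Q / s1 = (Q + s1) / s1" "1 + Q / (s1 + s2) = (Q + s1 + s2) / (s1 + s2)"
      using s1_pos s2_pos by (simp_all add: field_simps)
    then show ?thesis by simp
  qed
  moreover have "ln ((1 + Q / s1) / (1 + Q / (s1 + s2))) = ln (1 + Q / s1) - ln (1 + Q / (s1 + s2))"
  proof -
    have "1 + Q / s1 > 0" "1 + Q / (s1 + s2) > 0"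
      using Q s1_pos s2_pos by (auto intro!: add_pos_nonneg divide_nonneg_pos)
    then show ?thesis by (simp add: ln_div)
  qed
  ultimately have lnq: "ln ((Q + s1) * (s1 + s2) / (s1 * (Q + s1 + s2))) = ln (1 + Q / s1) - ln (1 + Q / (s1 + s2))"
    by simp
  have M: "ln (real M1 * real M2) = ln (real M1) + ln (real M2)"
    using M_ge1 by (intro ln_mult_pos) auto
  define H where "H = conditional_entropy 2 (count_space UNIV) (Leb N) msgs (chan_Z N f1 f2)"
  have "H * ln 2 \<le> real N / 2 * (ln (1 + Q / s1) - ln (1 + Q / (s1 + s2))) + ln 2 + P_err * (ln (real M1) + ln (real M2))"
    using code_bounds(1) unfolding H_def[symmetric] Q_def[symmetric] lnq M .
  then have "H \<le> (real N / 2 * (ln (1 + Q / s1) - ln (1 + Q / (s1 + s2))) + ln 2 + P_err * (ln (real M1) + ln (real M2))) / ln 2"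
    by (simp add: pos_le_divide_eq)
  \<comment> \<open>Division by \<open>ln 2\<close> passes from nats to bits; the Fano constant
    \<open>ln 2\<close> becomes one bit.\<close>
  also have "\<dots> = real N * (1 / 2 * log 2 (1 + Q / s1) - 1 / 2 * log 2 (1 + Q / (s1 + s2))) + (1 + P_err * (log 2 (real M1) + log 2 (real M2)))"
    unfolding log_def by (simp add: field_simps)
  finally have "H / real N \<le> (real N * (1 / 2 * log 2 (1 + Q / s1) - 1 / 2 * log 2 (1 + Q / (s1 + s2))) + (1 + P_err * (log 2 (real M1) + log 2 (real M2)))) / real N"
    by (intro divide_right_mono) auto
  then show "equivocation N M1 M2 s1 s2 f1 f2 \<le> sum_rate_bound P1 P2 s1 s2 \<rho> + (1 + P_err * (log 2 (real M1) + log 2 (real M2))) / real N"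
    using N_pos by (simp add: equivocation_def H_def[symmetric] sum_rate_bound_def Q_eq add_divide_distrib)
  have "(s1 + (P2 - cor\<^sup>2 / P1)) / s1 = 1 + (1 - \<rho>\<^sup>2) * P2 / s1"
    unfolding cor2 using s1_pos by (simp add: field_simps)
  with code_bounds(2) have "ln (real M2) \<le> real N / 2 * ln (1 + (1 - \<rho>\<^sup>2) * P2 / s1) + ln 2 + P_err * ln (real M2)"
    by simp
  then have "ln (real M2) / ln 2 \<le> (real N / 2 * ln (1 + (1 - \<rho>\<^sup>2) * P2 / s1) + ln 2 + P_err * ln (real M2)) / ln 2"
    by (intro divide_right_mono) auto
  also have "\<dots> = real N * (1 / 2 * log 2 (1 + (1 - \<rho>\<^sup>2) * P2 / s1)) + (1 + P_err * log 2 (real M2))"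
    unfolding log_def by (simp add: field_simps)
  finally have "log 2 (real M2) / real N \<le> (real N * (1 / 2 * log 2 (1 + (1 - \<rho>\<^sup>2) * P2 / s1)) + (1 + P_err * log 2 (real M2))) / real N"
    unfolding log_def[symmetric] by (intro divide_right_mono) auto
  then show "log 2 (real M2) / real N \<le> rate2_bound P2 s1 \<rho> + (1 + P_err * log 2 (real M2)) / real N"
    using N_pos by (simp add: rate2_bound_def add_divide_distrib)
qed

text \<open>Only one sufficiently long block is needed for each \<open>\<delta>\<close>, so the
  \<open>\<rho>\<close> obtained may depend on \<open>\<delta>\<close>.\<close>

lemma achievable_approx:
  assumes P: "P1 > 0" "P2 > 0" "s1 > 0" "s2 > 0" and R: "(R1, R2) \<in> secrecy_region P1 P2 s1 s2"
    and \<delta>: "\<delta> > 0"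
  shows "R1 \<ge> 0 \<and> R2 \<ge> 0 \<and> (\<exists>\<rho>\<in>{-1..1}. R1 + R2 \<le> sum_rate_bound P1 P2 s1 s2 \<rho> + \<delta> \<and> R2 \<le> rate2_bound P2 s1 \<rho> + \<delta>)"
proof -
  \<comment> \<open>Chosen so that \<open>\<epsilon> + \<epsilon> * (R1 + R2)\<close>, the
    equivocation loss plus the Fano loss, equals \<open>\<delta> / 2\<close>. The absolute value
    keeps \<open>d\<close> positive before the rates are known to be nonnegative.\<close>
  define d where "d = 1 + \<bar>R1 + R2\<bar>"
  define \<epsilon> where "\<epsilon> = \<delta> / 2 / d"
  have "d > 0" by (simp add: d_def)
  with \<delta> have \<epsilon>: "\<epsilon> > 0" "\<epsilon> * d = \<delta> / 2" by (simp_all add: \<epsilon>_def)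
  obtain N0 where N0: "\<And>N. N \<ge> N0 \<Longrightarrow> \<exists>M1 M2 f1 f2 \<psi>. valid_code N M1 M2 P1 P2 s1 s2 f1 f2 \<psi> \<and>
       log 2 (real M1) / real N = R1 \<and> log 2 (real M2) / real N = R2 \<and>
       equivocation N M1 M2 s1 s2 f1 f2 \<ge> R1 + R2 - \<epsilon> \<and>
       err_prob N M1 M2 s1 s2 f1 f2 \<psi> \<le> \<epsilon>"
    using R \<epsilon> unfolding secrecy_region_def by blast
  obtain K :: nat where K: "real K > 2 / \<delta>" using reals_Archimedean2 by blast
  \<comment> \<open>Long enough for the code to exist and for
    \<open>1 / N \<le> \<delta> / 2\<close>; the 1 makes \<open>N\<close> positive.\<close>
  define N where "N = max N0 (max K 1)"
  have N: "N > 0" "N \<ge> N0" "real N > 2 / \<delta>" using K by (auto simp: N_def)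
  have inv: "1 / real N \<le> \<delta> / 2" using N \<delta> by (simp add: field_simps)
  obtain M1 M2 f1 f2 \<psi> where code: "valid_code N M1 M2 P1 P2 s1 s2 f1 f2 \<psi>"
    and R1: "log 2 (real M1) / real N = R1" and R2: "log 2 (real M2) / real N = R2"
    and eq: "equivocation N M1 M2 s1 s2 f1 f2 \<ge> R1 + R2 - \<epsilon>"
    and err: "err_prob N M1 M2 s1 s2 f1 f2 \<psi> \<le> \<epsilon>"
    using N0[OF N(2)] by blast
  interpret wiretap_code N M1 M2 P1 P2 s1 s2 f1 f2 \<psi>
    using code N P by unfold_locales auto
  have nn: "R1 \<ge> 0" "R2 \<ge> 0" using M_ge1 R1 R2 by auto
  obtain \<rho> where \<rho>: "\<rho> \<in> {-1..1}"
    and b1: "equivocation N M1 M2 s1 s2 f1 f2 \<le> sum_rate_bound P1 P2 s1 s2 \<rho> + (1 + P_err * (log 2 (real M1) + log 2 (real M2))) / real N"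
    and b2: "log 2 (real M2) / real N \<le> rate2_bound P2 s1 \<rho> + (1 + P_err * log 2 (real M2)) / real N"
    using code_rate_bounds by blast
  \<comment> \<open>Since the log sizes of the message sets are \<open>N\<close> times the rates,
    the per-letter Fano term is the error probability times a rate, and is small because
    \<open>P_err \<le> \<epsilon>\<close>.\<close>
  have "(1 + P_err * (log 2 (real M1) + log 2 (real M2))) / real N = 1 / real N + P_err * (R1 + R2)"
    "(1 + P_err * log 2 (real M2)) / real N = 1 / real N + P_err * R2"
    unfolding R1[symmetric] R2[symmetric] by (simp_all add: add_divide_distrib distrib_left)
  moreover have "P_err * (R1 + R2) \<le> \<epsilon> * (R1 + R2)" "P_err * R2 \<le> \<epsilon> * R2"
    using err nn by (auto intro: mult_right_mono)
  moreover have "\<epsilon> + \<epsilon> * (R1 + R2) = \<delta> / 2" using \<epsilon>(2) nn by (simp add: d_def distrib_left)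
  moreover have "\<epsilon> * R2 \<le> \<epsilon> * (R1 + R2)" using nn \<epsilon> by simp
  ultimately have "R1 + R2 \<le> sum_rate_bound P1 P2 s1 s2 \<rho> + \<delta>" "R2 \<le> rate2_bound P2 s1 \<rho> + \<delta>"
    using eq b1 b2 inv \<epsilon>(1) unfolding R2 by linarith+
  then show ?thesis using nn \<rho> by blast
qed

theorem theorem7:
  fixes P1 P2 s1 s2 :: real
  assumes "P1 > 0" and "P2 > 0" and "s1 > 0" and "s2 > 0"
  shows "secrecy_region P1 P2 s1 s2 \<subseteq> outer_region P1 P2 s1 s2"
proof (rule subrelI)
  fix R1 R2 assume R: "(R1, R2) \<in> secrecy_region P1 P2 s1 s2"
  note approx = achievable_approx[OF assms R]
  \<comment> \<open>The larger of the two violations at \<open>\<rho>\<close>; both bounds hold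
    there exactly when \<open>h \<rho> \<le> 0\<close>. With a single function, one minimiser over
    the compact interval serves both bounds.\<close>
  define h where "h \<rho> = max (R1 + R2 - sum_rate_bound P1 P2 s1 s2 \<rho>) (R2 - rate2_bound P2 s1 \<rho>)" for \<rho>
  \<comment> \<open>By the arithmetic-geometric mean inequality the received power stays nonnegative
    down to \<open>\<rho> = -1\<close>. This keeps the arguments of the logarithms positive, as
    continuity of \<open>h\<close> requires.\<close>
  have q: "0 \<le> P1 + P2 + 2 * sqrt (P1 * P2) * \<rho>" if "\<rho> \<in> {-1..1}" for \<rho>
  proof -
    have "2 * sqrt (P1 * P2) \<le> P1 + P2" using arith_geo_mean_sqrt[of P1 P2] assms by simp
    moreover have "sqrt (P1 * P2) * (-1) \<le> sqrt (P1 * P2) * \<rho>"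
      using that assms by (intro mult_left_mono) auto
    ultimately show ?thesis by linarith
  qed
  have pos: "1 + (P1 + P2 + 2 * sqrt (P1 * P2) * \<rho>) / s1 > 0" "1 + (P1 + P2 + 2 * sqrt (P1 * P2) * \<rho>) / (s1 + s2) > 0"
     "1 + (1 - \<rho>\<^sup>2) * P2 / s1 > 0" if "\<rho> \<in> {-1..1}" for \<rho>
  proof -
    have "\<rho>\<^sup>2 \<le> 1" using that by (auto simp: abs_square_le_1)
    then show "1 + (P1 + P2 + 2 * sqrt (P1 * P2) * \<rho>) / s1 > 0" "1 + (P1 + P2 + 2 * sqrt (P1 * P2) * \<rho>) / (s1 + s2) > 0"
       "1 + (1 - \<rho>\<^sup>2) * P2 / s1 > 0"
      using q[OF that] assms by (auto intro!: add_pos_nonneg divide_nonneg_pos)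
  qed
  have "continuous_on {-1..1} h"
    unfolding h_def sum_rate_bound_def rate2_bound_def log_def
    by (intro continuous_intros) (use assms pos in \<open>auto simp: less_imp_neq[symmetric]\<close>)
  then obtain \<rho> where \<rho>: "\<rho> \<in> {-1..1}" and min: "\<And>\<rho>'. \<rho>' \<in> {-1..1} \<Longrightarrow> h \<rho> \<le> h \<rho>'"
    using continuous_attains_inf[of "{-1..1::real}" h] by auto
  have "h \<rho> \<le> 0 + \<delta>" if \<delta>: "\<delta> > 0" for \<delta>
  proof -
    obtain \<rho>' where "\<rho>' \<in> {-1..1}" "R1 + R2 \<le> sum_rate_bound P1 P2 s1 s2 \<rho>' + \<delta>" "R2 \<le> rate2_bound P2 s1 \<rho>' + \<delta>"
      using approx[OF \<delta>] by blast
    then have "h \<rho>' \<le> \<delta>" by (simp add: h_def)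
    with min[OF \<open>\<rho>' \<in> {-1..1}\<close>] show ?thesis by simp
  qed
  then have "h \<rho> \<le> 0" by (rule field_le_epsilon)
  then show "(R1, R2) \<in> outer_region P1 P2 s1 s2"
    \<comment> \<open>The value 1 is arbitrary: \<open>approx\<close> supplies the nonnegativity of
      the rates here.\<close>
    using \<rho> approx[of 1] unfolding outer_region_def h_def sum_rate_bound_def rate2_bound_def by auto
qed

end
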